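(* Assume the Continuum Hypothesis. Let $\omega^* = \beta\omega \setminus \omega$ and let $x$ be a point of $\omega^*$. Then every finite compactification of $\omega^* \setminus \{x\}$ is homeomorphic to $\omega^*$. Moreover, for every finite compactification $Z$ of $\omega^* \setminus \{x\}$, at most one point of the remainder $Z \setminus (\omega^* \setminus \{x\})$ is not a $P$-point of $Z$.
   Context: $\omega^* = \beta\omega\setminus\omega$ is the Stone-Čech remainder of the countable discrete space $\omega$. A finite compactification of a space $Y$ is a compact Hausdorff space $Z$ containing $Y$ as a dense subspace such that the remainder $Z \setminus Y$ is finite. A point $p$ of a space $Z$ is a $P$-point if every intersection of countably many neighbourhoods of $p$ contains an open neighbourhood of $p$. *)

theory Defs
  imports "HOL-Analysis.Analysis"
begin

definition continuum_hypothesis :: bool where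
  "continuum_hypothesis \<longleftrightarrow> (\<forall>A :: real set. uncountable A \<longrightarrow> A \<approx> (UNIV :: real set))"

definition ultrafilter :: "'a filter \<Rightarrow> bool" where
  "ultrafilter F \<longleftrightarrow>
     F \<noteq> bot \<and> (\<forall>P. eventually P F \<or> eventually (\<lambda>x. \<not> P x) F)"

(* The Stone space of ultrafilters on nat.  It is the Stone-Cech compactification of the
   discrete space nat, by beta_omega_compactification and beta_omega_extension below. *)
definition beta_omega :: "nat filter topology" where
  "beta_omega =
     topology_generated_by {{F. ultrafilter F \<and> eventually (\<lambda>n. n \<in> A) F} |A. True}"

definition omega_star :: "nat filter topology" where
  "omega_star =
     subtopology beta_omega (topspace beta_omega - range (\<lambda>n. principal {n}))"

(* Y sits in Z by way of an embedding e, so that Z may have points of any type. *)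
definition compactification :: "'a topology \<Rightarrow> 'b topology \<Rightarrow> ('a \<Rightarrow> 'b) \<Rightarrow> bool" where
  "compactification Y Z e \<longleftrightarrow>
     compact_space Z \<and> Hausdorff_space Z \<and>
     embedding_map Y Z e \<and> Z closure_of (e ` topspace Y) = topspace Z"

definition finite_compactification :: "'a topology \<Rightarrow> 'b topology \<Rightarrow> ('a \<Rightarrow> 'b) \<Rightarrow> bool" where
  "finite_compactification Y Z e \<longleftrightarrow>
     compactification Y Z e \<and> finite (topspace Z - e ` topspace Y)"

definition neighbourhood :: "'a topology \<Rightarrow> 'a \<Rightarrow> 'a set \<Rightarrow> bool" where
  "neighbourhood Z p N \<longleftrightarrow> N \<subseteq> topspace Z \<and> (\<exists>U. openin Z U \<and> p \<in> U \<and> U \<subseteq> N)"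

definition P_point :: "'a topology \<Rightarrow> 'a \<Rightarrow> bool" where
  "P_point Z p \<longleftrightarrow> p \<in> topspace Z \<and>
     (\<forall>\<N>. countable \<N> \<and> (\<forall>N\<in>\<N>. neighbourhood Z p N) \<longrightarrow>
        (\<exists>U. openin Z U \<and> p \<in> U \<and> U \<subseteq> \<Inter>\<N>))"


lemma ultrafilter_not_iff:
  assumes "ultrafilter F"
  shows "eventually (\<lambda>x. \<not> P x) F \<longleftrightarrow> \<not> eventually P F"
proof -
  have "False" if "eventually P F" "eventually (\<lambda>x. \<not> P x) F"
    using eventually_conj[OF that] assms by (simp add: ultrafilter_def)
  then show ?thesis using assms unfolding ultrafilter_def by blast
qed

lemma ultrafilter_principal: "ultrafilter (principal {n})"
  by (auto simp: ultrafilter_def eventually_principal principal_eq_bot_iff)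

lemma ultrafilter_exists:
  fixes F :: "'a filter"
  assumes "F \<noteq> bot"
  obtains U where "ultrafilter U" "U \<le> F"
proof -
  define S where "S = {G. G \<noteq> bot \<and> G \<le> F}"
  have "\<exists>m\<in>S. \<forall>a\<in>S. m \<ge> a \<longrightarrow> a = m"
  proof (rule predicate_Zorn[where P = "\<lambda>x y. y \<le> x"])
    show "partial_order_on S (relation_of (\<lambda>x y. y \<le> x) S)"
      by (rule partial_order_on_relation_ofI) auto
  next
    fix C assume C: "C \<in> Chains (relation_of (\<lambda>x y. y \<le> x) S)"
    then have CS: "C \<subseteq> S" by (rule Chains_relation_of)
    have lin: "G \<le> H \<or> H \<le> G" if "G \<in> C" "H \<in> C" for G H
      using C that by (auto simp: Chains_def relation_of_def)
    show "\<exists>u\<in>S. \<forall>a\<in>C. u \<le> a"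
    proof (cases "C = {}")
      case True then show ?thesis using assms by (auto simp: S_def)
    next
      case False
      have "Inf C \<noteq> bot"
      proof
        assume "Inf C = bot"
        then have "eventually (\<lambda>x. False) (Inf C)" by simp
        then obtain G where "G \<in> C" "eventually (\<lambda>x. False) G"
          using eventually_Inf_base[OF False] lin by (metis inf.order_iff inf_commute order_refl)
        then show False using CS by (auto simp: S_def)
      qed
      moreover have "Inf C \<le> F"
        using False CS by (metis Inf_lower2 S_def ex_in_conv mem_Collect_eq subsetD)
      ultimately show ?thesis by (auto simp: S_def Inf_lower)
    qed
  qed
  then obtain U where U: "U \<noteq> bot" "U \<le> F" and min: "\<And>G. \<lbrakk>G \<noteq> bot; G \<le> U\<rbrakk> \<Longrightarrow> G = U"
    unfolding S_def by (metis (mono_tags, lifting) mem_Collect_eq order_trans)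
  have "ultrafilter U"
    unfolding ultrafilter_def
  proof (intro conjI allI)
    fix P
    show "eventually P U \<or> eventually (\<lambda>x. \<not> P x) U"
    proof (cases "inf U (principal {x. P x}) = bot")
      case True
      then have "eventually (\<lambda>x. False) (inf U (principal {x. P x}))" by simp
      then show ?thesis by (simp add: eventually_inf_principal)
    next
      case False
      then have "U \<le> principal {x. P x}"
        using min by (metis inf.cobounded1 inf.cobounded2)
      then show ?thesis by (simp add: le_principal)
    qed
  qed (fact U)
  then show thesis using U that by blast
qed

lemma topspace_beta_omega: "topspace beta_omega = {F. ultrafilter F}"
proof -
  have "\<Union>{{F. ultrafilter F \<and> eventually (\<lambda>n. n \<in> A) F} |A :: nat set. True} = {F. ultrafilter F}"
  proof (intro subset_antisym subsetI)
    fix F :: "nat filter" assume "F \<in> {F. ultrafilter F}"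
    then have "F \<in> {F. ultrafilter F \<and> eventually (\<lambda>n. n \<in> (UNIV :: nat set)) F}" by simp
    then show "F \<in> \<Union>{{F. ultrafilter F \<and> eventually (\<lambda>n. n \<in> A) F} |A :: nat set. True}" by blast
  qed blast
  then show ?thesis by (simp add: beta_omega_def)
qed

lemma openin_beta_omega_basic:
  "openin beta_omega {F. ultrafilter F \<and> eventually (\<lambda>n. n \<in> A) F}"
  unfolding beta_omega_def by (rule topology_generated_by_Basis) auto

lemma openin_beta_omega_iff:
  "openin beta_omega W \<longleftrightarrow>
     (\<forall>F\<in>W. ultrafilter F \<and>
        (\<exists>A. eventually (\<lambda>n. n \<in> A) F \<and> {G. ultrafilter G \<and> eventually (\<lambda>n. n \<in> A) G} \<subseteq> W))"
  (is "_ \<longleftrightarrow> ?B W")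
proof
  assume "openin beta_omega W"
  then have "generate_topology_on {{F. ultrafilter F \<and> eventually (\<lambda>n. n \<in> A) F} |A. True} W"
    by (simp add: beta_omega_def openin_topology_generated_by_iff)
  then show "?B W"
  proof induction
    case (Int V W)
    show ?case
    proof
      fix F assume F: "F \<in> V \<inter> W"
      obtain A where A: "eventually (\<lambda>n. n \<in> A) F"
          "{G. ultrafilter G \<and> eventually (\<lambda>n. n \<in> A) G} \<subseteq> V"
        using F Int.IH(1) by blast
      obtain B where B: "eventually (\<lambda>n. n \<in> B) F"
          "{G. ultrafilter G \<and> eventually (\<lambda>n. n \<in> B) G} \<subseteq> W"
        using F Int.IH(2) by blast
      have "eventually (\<lambda>n. n \<in> A \<inter> B) F" using A B by (simp add: eventually_conj)
      moreover have "{G. ultrafilter G \<and> eventually (\<lambda>n. n \<in> A \<inter> B) G} \<subseteq> V \<inter> W"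
        using A B by (auto simp: eventually_conj_iff)
      ultimately show "ultrafilter F \<and> (\<exists>A. eventually (\<lambda>n. n \<in> A) F \<and>
          {G. ultrafilter G \<and> eventually (\<lambda>n. n \<in> A) G} \<subseteq> V \<inter> W)"
        using F Int.IH(1) by blast
    qed
  next
    case (UN K) then show ?case by (meson Union_iff Union_upper order_trans)
  qed auto
next
  assume B: "?B W"
  show "openin beta_omega W"
    unfolding openin_subopen[of _ W]
  proof
    fix F assume "F \<in> W"
    then obtain A where A: "ultrafilter F" "eventually (\<lambda>n. n \<in> A) F"
        "{G. ultrafilter G \<and> eventually (\<lambda>n. n \<in> A) G} \<subseteq> W"
      using B by blast
    then show "\<exists>T. openin beta_omega T \<and> F \<in> T \<and> T \<subseteq> W"
      using openin_beta_omega_basic[of A] by blast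
  qed
qed

lemma compact_space_beta_omega: "compact_space beta_omega"
  unfolding compact_space_alt
proof (intro allI impI)
  fix \<U> assume \<U>: "(\<forall>U\<in>\<U>. openin beta_omega U) \<and> topspace beta_omega \<subseteq> \<Union>\<U>"
  define \<A> where "\<A> = {A. \<exists>U\<in>\<U>. {F. ultrafilter F \<and> eventually (\<lambda>n. n \<in> A) F} \<subseteq> U}"
  have cov: "\<exists>A\<in>\<A>. eventually (\<lambda>n. n \<in> A) F" if F: "ultrafilter F" for F
  proof -
    obtain U where U: "U \<in> \<U>" "F \<in> U" using \<U> F unfolding topspace_beta_omega by blast
    then have "openin beta_omega U" using \<U> by blast
    with U show ?thesis unfolding openin_beta_omega_iff \<A>_def by blast
  qed
  define G where "G = (INF A\<in>\<A>. principal (- A))"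
  have "G = bot"
  proof (rule ccontr)
    assume "G \<noteq> bot"
    then obtain F where F: "ultrafilter F" "F \<le> G" by (rule ultrafilter_exists)
    obtain A where A: "A \<in> \<A>" "eventually (\<lambda>n. n \<in> A) F" using cov[OF F(1)] by blast
    have "F \<le> principal (- A)"
      using F(2) A(1) unfolding G_def by (meson INF_lower order_trans)
    then have "eventually (\<lambda>n. \<not> n \<in> A) F" by (simp add: le_principal)
    with A(2) show False using ultrafilter_not_iff[OF F(1)] by blast
  qed
  then have "eventually (\<lambda>x. False) (INF A\<in>\<A>. principal (- A))"
    by (simp add: G_def)
  from iffD1[OF eventually_INF this] obtain \<F> where fin: "\<F> \<subseteq> \<A>" "finite \<F>"
      "eventually (\<lambda>x. False) (INF A\<in>\<F>. principal (- A))"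
    by blast
  have "\<forall>n\<in>(\<Inter>A\<in>\<F>. - A). False"
    using fin(3) unfolding INF_principal_finite[OF fin(2)] eventually_principal .
  then have full: "\<exists>A\<in>\<F>. n \<in> A" for n by blast
  have hit: "\<exists>A\<in>\<F>. eventually (\<lambda>n. n \<in> A) F" if F: "ultrafilter F" for F
  proof (rule ccontr)
    assume "\<not> ?thesis"
    then have "\<forall>A\<in>\<F>. eventually (\<lambda>n. n \<notin> A) F"
      using ultrafilter_not_iff[OF F] by blast
    then have "eventually (\<lambda>n. \<forall>A\<in>\<F>. n \<notin> A) F"
      using fin(2) by (simp add: eventually_ball_finite)
    then have "eventually (\<lambda>n. False) F" by (rule eventually_mono) (use full in blast)
    then show False using F by (simp add: ultrafilter_def)
  qed
  have "\<forall>A\<in>\<F>. \<exists>U. U \<in> \<U> \<and> {F. ultrafilter F \<and> eventually (\<lambda>n. n \<in> A) F} \<subseteq> U"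
    using fin(1) unfolding \<A>_def by blast
  then obtain u where u: "\<forall>A\<in>\<F>.
      u A \<in> \<U> \<and> {F. ultrafilter F \<and> eventually (\<lambda>n. n \<in> A) F} \<subseteq> u A"
    unfolding bchoice_iff by (rule exE)
  show "\<exists>\<F>. finite \<F> \<and> \<F> \<subseteq> \<U> \<and> topspace beta_omega \<subseteq> \<Union>\<F>"
  proof (intro exI[of _ "u ` \<F>"] conjI)
    show "topspace beta_omega \<subseteq> \<Union>(u ` \<F>)"
      using hit u unfolding topspace_beta_omega by blast
  qed (use fin(2) u in auto)
qed

lemma Hausdorff_space_beta_omega: "Hausdorff_space beta_omega"
  unfolding Hausdorff_space_def topspace_beta_omega
proof (intro allI impI)
  fix F G :: "nat filter"
  assume "F \<in> {F. ultrafilter F} \<and> G \<in> {F. ultrafilter F} \<and> F \<noteq> G"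
  then have FG: "ultrafilter F" "ultrafilter G" "F \<noteq> G" by auto
  then obtain P where P: "eventually P F \<noteq> eventually P G" by (auto simp: filter_eq_iff)
  obtain Q where Q: "eventually Q F" "\<not> eventually Q G"
  proof (cases "eventually P F")
    case False
    then show ?thesis
      using that[of "\<lambda>x. \<not> P x"] P FG by (simp add: ultrafilter_not_iff)
  qed (use that P in blast)
  let ?b = "\<lambda>A. {F. ultrafilter F \<and> eventually (\<lambda>n. n \<in> A) F}"
  have "F \<in> ?b {n. Q n}" "G \<in> ?b {n. \<not> Q n}" using Q FG by (auto simp: ultrafilter_not_iff)
  moreover have "disjnt (?b {n. Q n}) (?b {n. \<not> Q n})"
    by (auto simp: disjnt_def ultrafilter_not_iff)
  ultimately show "\<exists>U V. openin beta_omega U \<and> openin beta_omega V \<and> F \<in> U \<and> G \<in> V \<and> disjnt U V"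
    using openin_beta_omega_basic by blast
qed

lemma beta_omega_compactification:
  "compactification (discrete_topology UNIV) beta_omega (\<lambda>n. principal {n})"
  unfolding compactification_def
proof (intro conjI)
  let ?e = "\<lambda>n::nat. principal {n}"
  show "embedding_map (discrete_topology UNIV) beta_omega ?e"
  proof (rule injective_open_imp_embedding_map)
    show "continuous_map (discrete_topology UNIV) beta_omega ?e"
      by (auto simp: topspace_beta_omega ultrafilter_principal)
    show "open_map (discrete_topology UNIV) beta_omega ?e"
      unfolding open_map_def
    proof (intro allI impI)
      fix A :: "nat set"
      have *: "F = principal {n}" if "ultrafilter F" "eventually (\<lambda>m. m = n) F" for F and n :: nat
      proof -
        have "eventually P F \<longleftrightarrow> P n" for P
        proof
          assume "eventually P F"
          with that(2) have "eventually (\<lambda>m. P n) F" by eventually_elim auto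
          then show "P n" using that(1) by (auto simp: ultrafilter_def eventually_const)
        next
          assume "P n"
          then show "eventually P F" using that(2) by (auto elim: eventually_mono)
        qed
        then show ?thesis by (simp add: filter_eq_iff eventually_principal)
      qed
      show "openin beta_omega (?e ` A)"
        unfolding openin_beta_omega_iff
      proof
        fix F assume "F \<in> ?e ` A"
        then obtain n where n: "n \<in> A" "F = principal {n}" by blast
        have "eventually (\<lambda>m. m \<in> {n}) F"
          using n(2) by (simp add: eventually_principal)
        moreover have "{G. ultrafilter G \<and> eventually (\<lambda>m. m \<in> {n}) G} \<subseteq> ?e ` A"
          using *[of _ n] n(1) by auto
        ultimately show "ultrafilter F \<and> (\<exists>B. eventually (\<lambda>n. n \<in> B) F \<and>
            {G. ultrafilter G \<and> eventually (\<lambda>n. n \<in> B) G} \<subseteq> ?e ` A)"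
          using n(2) ultrafilter_principal by (metis (no_types))
      qed
    qed
  qed (auto simp: inj_on_def)
  show "beta_omega closure_of (?e ` topspace (discrete_topology UNIV)) = topspace beta_omega"
    unfolding dense_intersects_open
  proof (intro allI impI)
    fix T assume T: "openin beta_omega T \<and> T \<noteq> {}"
    then obtain F where F: "F \<in> T" by blast
    then obtain A where A: "ultrafilter F" "eventually (\<lambda>n. n \<in> A) F"
        "{G. ultrafilter G \<and> eventually (\<lambda>n. n \<in> A) G} \<subseteq> T"
      using T unfolding openin_beta_omega_iff by blast
    then obtain n where "n \<in> A" by (metis eventually_happens ultrafilter_def)
    then have "principal {n} \<in> T"
      using A(3) by (auto simp: ultrafilter_principal eventually_principal)
    then show "?e ` topspace (discrete_topology UNIV) \<inter> T \<noteq> {}" by auto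
  qed
qed (fact compact_space_beta_omega Hausdorff_space_beta_omega)+

lemma beta_omega_extension:
  fixes f :: "nat \<Rightarrow> 'a"
  assumes K: "compact_space K" "Hausdorff_space K" and f: "range f \<subseteq> topspace K"
  shows "\<exists>g. continuous_map beta_omega K g \<and> (\<forall>n. g (principal {n}) = f n)"
proof -
  have lim: "\<exists>l. limitin K f l F" if F: "ultrafilter F" for F
  proof (rule ccontr)
    assume no: "\<not> ?thesis"
    define \<U> where "\<U> = {U. openin K U \<and> \<not> eventually (\<lambda>n. f n \<in> U) F}"
    have "topspace K \<subseteq> \<Union>\<U>" using no unfolding \<U>_def limitin_def by blast
    then obtain \<F> where \<F>: "finite \<F>" "\<F> \<subseteq> \<U>" "topspace K \<subseteq> \<Union>\<F>"
      using K(1) unfolding compact_space_alt \<U>_def by (metis (no_types, lifting) mem_Collect_eq)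
    have "\<forall>U\<in>\<F>. eventually (\<lambda>n. f n \<notin> U) F"
      using \<F>(2) ultrafilter_not_iff[OF F] unfolding \<U>_def by blast
    then have "eventually (\<lambda>n. \<forall>U\<in>\<F>. f n \<notin> U) F"
      using \<F>(1) by (simp add: eventually_ball_finite)
    then have "eventually (\<lambda>n. False) F" by (rule eventually_mono) (use \<F>(3) f in blast)
    then show False using F by (simp add: ultrafilter_def)
  qed
  define g where "g F = (SOME l. limitin K f l F)" for F
  have g: "limitin K f (g F) F" if "ultrafilter F" for F
    unfolding g_def using lim[OF that] by (rule someI_ex)
  have "continuous_map beta_omega K g"
    unfolding continuous_map_def
  proof (intro conjI allI impI)
    show "g \<in> topspace beta_omega \<rightarrow> topspace K"
      using g limitin_topspace by (fastforce simp: topspace_beta_omega)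
    fix W assume W: "openin K W"
    show "openin beta_omega {F \<in> topspace beta_omega. g F \<in> W}"
      unfolding openin_beta_omega_iff
    proof
      fix F assume "F \<in> {F \<in> topspace beta_omega. g F \<in> W}"
      then have F: "ultrafilter F" "g F \<in> W" by (auto simp: topspace_beta_omega)
      have "neighbourhood_base_of (closedin K) K"
        using compact_Hausdorff_imp_regular_space[OF K] by (simp add: neighbourhood_base_of_closedin)
      then obtain V C where V: "openin K V" "closedin K C" "g F \<in> V" "V \<subseteq> C" "C \<subseteq> W"
        unfolding neighbourhood_base_of using W F(2) by meson
      have "eventually (\<lambda>n. n \<in> f -` V) F"
        using limitinD[OF g[OF F(1)] V(1) V(3)] by simp
      moreover have "g G \<in> W" if G: "ultrafilter G" "eventually (\<lambda>n. n \<in> f -` V) G" for G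
      proof -
        have "g G \<in> C"
        proof (rule limitin_closedin[OF g[OF G(1)] V(2)])
          show "eventually (\<lambda>n. f n \<in> C) G" using G(2) V(4) by (auto elim: eventually_mono)
          show "G \<noteq> bot" using G(1) by (simp add: ultrafilter_def)
        qed
        then show ?thesis using V(5) by blast
      qed
      ultimately show "ultrafilter F \<and> (\<exists>A. eventually (\<lambda>n. n \<in> A) F \<and>
          {G. ultrafilter G \<and> eventually (\<lambda>n. n \<in> A) G} \<subseteq> {F \<in> topspace beta_omega. g F \<in> W})"
        using F(1) unfolding topspace_beta_omega by (intro conjI exI[of _ "f -` V"]) auto
    qed
  qed
  moreover have "g (principal {n}) = f n" for n
  proof (rule limitin_Hausdorff_unique[OF g[OF ultrafilter_principal]])
    show "limitin K f (f n) (principal {n})"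
      using f by (auto simp: limitin_def eventually_principal)
  qed (use K in \<open>auto simp: principal_eq_bot_iff\<close>)
  ultimately show ?thesis by blast
qed

end

theory Submission
  imports Defs
begin

text \<open>By the F-space property of \<^term>\<open>omega_star\<close>, of two disjoint open \<open>F\<^sub>\<sigma>\<close>-sets at most one has
  \<open>x\<close> in its closure; so at most one point of the remainder is a limit of a countable union of
  clopen sets that miss the remainder, which bounds the number of remainder points that are not P-points.
  The same observation shows that \<open>Z\<close> inherits from \<^term>\<open>omega_star\<close> the properties in
  Parovichenko's theorem: it is compact and zero-dimensional with at most continuum many clopen
  sets, disjoint countable families of clopen sets can be separated, and nonempty
  \<open>G\<^sub>\<delta>\<close>-sets have interior points but no isolated ones.  Under the continuum hypothesis
  any two such spaces are homeomorphic: a back-and-forth construction of length \<open>\<omega>\<^sub>1\<close>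
  produces an isomorphism between the algebras of clopen sets.\<close>

section \<open>Clopen sets and Parovichenko spaces\<close>

text \<open>Up to \<open>e\<close>, the clopen sets of \<open>X\<close> that avoid \<open>x\<close>
  are the clopen sets of \<open>Z\<close> that avoid the remainder; every property of
  \<open>Z\<close> is obtained through this dictionary. The obstacle is that a clopen set of
  \<open>Z\<close> meeting the remainder has no counterpart in \<open>X\<close>. It is overcome by
  working near one remainder point at a time, since a finite remainder leaves room for clopen
  neighbourhoods containing no other, or by taking differences in which the remainder cancels. In
  the back-and-forth construction the obstacle is that one extension step can respect only countably
  many earlier choices: the continuum hypothesis keeps every earlier stage countable, and limit
  stages cost nothing because being matched is tested on finite subsets.\<close>

definition clopens :: "'a topology \<Rightarrow> 'a set set" where
  "clopens X = {C. openin X C \<and> closedin X C}"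

lemma clopens_openin: "C \<in> clopens X \<Longrightarrow> openin X C"
  and clopens_closedin: "C \<in> clopens X \<Longrightarrow> closedin X C"
  by (auto simp: clopens_def)

lemma clopens_subset: "C \<in> clopens X \<Longrightarrow> C \<subseteq> topspace X"
  by (simp add: clopens_def openin_subset)

lemma clopens_empty [simp]: "{} \<in> clopens X"
  and clopens_topspace [simp]: "topspace X \<in> clopens X"
  by (auto simp: clopens_def)

lemma clopens_Int [simp]: "A \<in> clopens X \<Longrightarrow> B \<in> clopens X \<Longrightarrow> A \<inter> B \<in> clopens X"
  and clopens_Un [simp]: "A \<in> clopens X \<Longrightarrow> B \<in> clopens X \<Longrightarrow> A \<union> B \<in> clopens X"
  and clopens_Diff [simp]: "A \<in> clopens X \<Longrightarrow> B \<in> clopens X \<Longrightarrow> A - B \<in> clopens X"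
  by (auto simp: clopens_def openin_diff closedin_diff)

lemma clopens_Union: "finite \<F> \<Longrightarrow> \<F> \<subseteq> clopens X \<Longrightarrow> \<Union>\<F> \<in> clopens X"
  by (auto simp: clopens_def intro: closedin_Union)

text \<open>The factor \<open>topspace X\<close> accounts for the empty family, whose
  \<open>\<Inter>\<close> is the whole type.\<close>

lemma clopens_finite_Inter:
  "finite \<F> \<Longrightarrow> \<F> \<subseteq> clopens X \<Longrightarrow> topspace X \<inter> \<Inter>\<F> \<in> clopens X"
proof (induction rule: finite_induct)
  case (insert C \<F>)
  have "topspace X \<inter> \<Inter>(insert C \<F>) = C \<inter> (topspace X \<inter> \<Inter>\<F>)" by auto
  then show ?case using insert by simp
qed simp

text \<open>Separating points is the weakest form of zero-dimensionality and the easiest to verify;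
  compactness upgrades it below to a clopen base and to clopen separation of disjoint closed
  sets.\<close>

locale stone_space =
  fixes X :: "'a topology"
  assumes compact: "compact_space X"
    and clopen_points: "\<lbrakk>p \<in> topspace X; q \<in> topspace X; p \<noteq> q\<rbrakk> \<Longrightarrow> \<exists>C\<in>clopens X. p \<in> C \<and> q \<notin> C"
begin

lemma Hausdorff: "Hausdorff_space X"
  unfolding Hausdorff_space_def
proof (intro allI impI)
  fix p q assume pq: "p \<in> topspace X \<and> q \<in> topspace X \<and> p \<noteq> q"
  then obtain C where C: "C \<in> clopens X" "p \<in> C" "q \<notin> C" using clopen_points by blast
  have "openin X C" "openin X (topspace X - C)" using C by (auto intro!: clopens_openin)
  then show "\<exists>U V. openin X U \<and> openin X V \<and> p \<in> U \<and> q \<in> V \<and> disjnt U V"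
    using C pq by (intro exI[of _ C] exI[of _ "topspace X - C"]) (auto simp: disjnt_def)
qed

lemma clopens_cover:
  assumes "closedin X K" "\<C> \<subseteq> clopens X" "K \<subseteq> \<Union>\<C>"
  shows "\<exists>\<F>. finite \<F> \<and> \<F> \<subseteq> \<C> \<and> K \<subseteq> \<Union>\<F> \<and> \<Union>\<F> \<in> clopens X"
proof -
  have "compactin X K" using closedin_compact_space[OF compact assms(1)] .
  then obtain \<F> where "finite \<F>" "\<F> \<subseteq> \<C>" "K \<subseteq> \<Union>\<F>"
    unfolding compactin_def using assms(2,3) clopens_openin by (metis subsetD)
  then show ?thesis using clopens_Union assms(2) by (metis order_trans)
qed

text \<open>Compactness of \<open>B\<close> gives finitely many clopen sets that miss
  \<open>p\<close> and cover \<open>B\<close>; the complement of their union works. A second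
  covering argument of this kind then separates two closed sets.\<close>

lemma clopen_point_closed:
  assumes "p \<in> topspace X" "closedin X B" "p \<notin> B"
  shows "\<exists>C\<in>clopens X. p \<in> C \<and> C \<inter> B = {}"
proof -
  have 1: "B \<subseteq> \<Union>{D \<in> clopens X. p \<notin> D}"
    using clopen_points[OF _ assms(1)] closedin_subset[OF assms(2)] assms(3) by fastforce
  have 2: "{D \<in> clopens X. p \<notin> D} \<subseteq> clopens X" by blast
  obtain \<F> where "finite \<F>" "\<F> \<subseteq> {D \<in> clopens X. p \<notin> D}"
      "B \<subseteq> \<Union>\<F>" "\<Union>\<F> \<in> clopens X"
    using clopens_cover[OF assms(2) 2 1] by (elim exE conjE)
  then show ?thesis using assms(1) by (intro bexI[of _ "topspace X - \<Union>\<F>"]) auto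
qed

lemma clopen_separation:
  assumes "closedin X A" "closedin X B" "A \<inter> B = {}"
  shows "\<exists>C\<in>clopens X. A \<subseteq> C \<and> C \<inter> B = {}"
proof -
  have 1: "A \<subseteq> \<Union>{C \<in> clopens X. C \<inter> B = {}}"
    using clopen_point_closed[OF _ assms(2)] closedin_subset[OF assms(1)] assms(3) by fastforce
  have 2: "{C \<in> clopens X. C \<inter> B = {}} \<subseteq> clopens X" by blast
  obtain \<F> where "finite \<F>" "\<F> \<subseteq> {C \<in> clopens X. C \<inter> B = {}}"
      "A \<subseteq> \<Union>\<F>" "\<Union>\<F> \<in> clopens X"
    using clopens_cover[OF assms(1) 2 1] by (elim exE conjE)
  then show ?thesis by (intro bexI[of _ "\<Union>\<F>"]) auto
qed

lemma clopen_neighbourhood: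
  assumes "openin X W" "p \<in> W"
  shows "\<exists>C\<in>clopens X. p \<in> C \<and> C \<subseteq> W"
proof -
  have "closedin X (topspace X - W)" "p \<in> topspace X" using assms openin_subset by auto
  then obtain C where "C \<in> clopens X" "p \<in> C" "C \<inter> (topspace X - W) = {}"
    using clopen_point_closed[of p "topspace X - W"] assms(2) by auto
  then show ?thesis using clopens_subset by blast
qed

lemma clopens_Inter_nonempty:
  assumes "\<C> \<subseteq> clopens X" "topspace X \<noteq> {}"
    and fin: "\<And>\<F>. \<lbrakk>finite \<F>; \<F> \<subseteq> \<C>\<rbrakk> \<Longrightarrow> topspace X \<inter> \<Inter>\<F> \<noteq> {}"
  shows "topspace X \<inter> \<Inter>\<C> \<noteq> {}"
proof -
  have "compactin X (topspace X)" using compact by (simp add: compact_space_def)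
  then show ?thesis
    unfolding compactin_fip using assms(1) fin clopens_closedin by (metis subsetD)
qed

end

text \<open>In compact spaces a relation between clopen sets is matched exactly when it extends to an
  isomorphism between the generated Boolean algebras.  Speaking about points avoids these algebras
  and makes the property one of finite character.\<close>

definition agree :: "('a set \<times> 'b set) set \<Rightarrow> 'a \<Rightarrow> 'b \<Rightarrow> bool" where
  "agree R s z \<longleftrightarrow> (\<forall>p\<in>R. s \<in> fst p \<longleftrightarrow> z \<in> snd p)"

definition matched :: "'a topology \<Rightarrow> 'b topology \<Rightarrow> ('a set \<times> 'b set) set \<Rightarrow> bool" where
  "matched X Z R \<longleftrightarrow> R \<subseteq> clopens X \<times> clopens Z \<and>
     (\<forall>s\<in>topspace X. \<exists>z\<in>topspace Z. agree R s z) \<and>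
     (\<forall>z\<in>topspace Z. \<exists>s\<in>topspace X. agree R s z)"

section \<open>Finite character of matched relations\<close>

lemma agree_mono: "agree R s z \<Longrightarrow> F \<subseteq> R \<Longrightarrow> agree F s z"
  unfolding agree_def by blast

lemma agree_converse: "agree (R\<inverse>) z s \<longleftrightarrow> agree R s z"
  unfolding agree_def by (force simp: Ball_def)

lemma agree_insert: "agree (insert (a, b) R) s z \<longleftrightarrow> (s \<in> a \<longleftrightarrow> z \<in> b) \<and> agree R s z"
  unfolding agree_def by simp

lemma matched_converse: "matched X Z R \<Longrightarrow> matched Z X (R\<inverse>)"
  unfolding matched_def agree_converse by auto

lemma matched_mono: "matched X Z R \<Longrightarrow> F \<subseteq> R \<Longrightarrow> matched X Z F"
  unfolding matched_def by (meson agree_mono order_trans)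

text \<open>For fixed \<open>s\<close>, each pair of \<open>R\<close> confines \<open>z\<close> to a
  clopen set or to its complement, so the finite intersection property applies.\<close>

lemma (in stone_space) agree_compactness:
  fixes R :: "('b set \<times> 'a set) set"
  assumes R: "snd ` R \<subseteq> clopens X"
    and fin: "\<And>F. \<lbrakk>finite F; F \<subseteq> R\<rbrakk> \<Longrightarrow> \<exists>z\<in>topspace X. agree F s z"
  shows "\<exists>z\<in>topspace X. agree R s z"
proof -
  define c where "c = (\<lambda>p. if s \<in> fst p then snd p else topspace X - snd p)"
  have c: "z \<in> \<Inter>(c ` F) \<longleftrightarrow> agree F s z" if "z \<in> topspace X" for z F
    using that by (auto simp: c_def agree_def)
  have "topspace X \<inter> \<Inter>(c ` R) \<noteq> {}"
  proof (rule clopens_Inter_nonempty)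
    show "c ` R \<subseteq> clopens X" using R by (auto simp: c_def split: prod.split)
    show "topspace X \<noteq> {}" using fin[of "{}"] by auto
    fix \<F> assume "finite \<F>" "\<F> \<subseteq> c ` R"
    then obtain F where "F \<subseteq> R" "finite F" "\<F> = c ` F" by (meson finite_subset_image)
    then show "topspace X \<inter> \<Inter>\<F> \<noteq> {}" using fin[of F] c by blast
  qed
  then show ?thesis using c by blast
qed

text \<open>Both quantifiers over points are handled one point at a time by
  \<open>agree_compactness\<close>. This is what later makes limit stages of the recursion
  automatic.\<close>

lemma matched_compactness:
  assumes "stone_space X" "stone_space Z"
    and fin: "\<And>F. \<lbrakk>finite F; F \<subseteq> R\<rbrakk> \<Longrightarrow> matched X Z F"
  shows "matched X Z R"
  unfolding matched_def
proof (intro conjI ballI)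
  show R: "R \<subseteq> clopens X \<times> clopens Z"
  proof
    fix p assume "p \<in> R"
    then have "matched X Z {p}" by (intro fin) auto
    then show "p \<in> clopens X \<times> clopens Z" by (simp add: matched_def)
  qed
  show "\<exists>z\<in>topspace Z. agree R s z" if "s \<in> topspace X" for s
  proof (rule stone_space.agree_compactness[OF assms(2)])
    show "snd ` R \<subseteq> clopens Z" using R by auto
    show "\<exists>z\<in>topspace Z. agree F s z" if "finite F" "F \<subseteq> R" for F
      using fin[OF that] \<open>s \<in> topspace X\<close> by (simp add: matched_def)
  qed
  have "\<exists>s\<in>topspace X. agree (R\<inverse>) z s" if "z \<in> topspace Z" for z
  proof (rule stone_space.agree_compactness[OF assms(1)])
    show "snd ` (R\<inverse>) \<subseteq> clopens X" using R by auto
    show "\<exists>s\<in>topspace X. agree F z s" if "finite F" "F \<subseteq> R\<inverse>" for F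
    proof -
      have "finite (F\<inverse>)" "F\<inverse> \<subseteq> R" using that by auto
      then have "matched X Z (F\<inverse>)" by (rule fin)
      then show ?thesis using \<open>z \<in> topspace Z\<close>
        by (metis agree_converse converse_converse matched_def)
    qed
  qed
  then show "\<exists>s\<in>topspace X. agree R s z" if "z \<in> topspace Z" for z
    using that by (simp add: agree_converse)
qed

text \<open>In a compact zero-dimensional space the open F-sigma sets are the countable unions of
  clopen sets, so \<open>separate\<close> is the F-space property. Asking for two disjoint sets in
  \<open>thick\<close> merges two classical conditions: nonempty G-delta sets have interior, and no
  point is isolated.\<close>

locale parovicenko_space = stone_space X for X :: "'a topology" +
  assumes nonempty: "topspace X \<noteq> {}"
    and few_clopens: "clopens X \<lesssim> (UNIV :: real set)"
    and separate: "\<lbrakk>countable \<A>; countable \<B>; \<A> \<subseteq> clopens X; \<B> \<subseteq> clopens X;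
        \<And>A B. A \<in> \<A> \<Longrightarrow> B \<in> \<B> \<Longrightarrow> A \<inter> B = {}\<rbrakk> \<Longrightarrow>
        \<exists>C\<in>clopens X. \<Union>\<A> \<subseteq> C \<and> C \<inter> \<Union>\<B> = {}"
    and thick: "\<lbrakk>countable \<C>; \<C> \<subseteq> clopens X; p \<in> topspace X; p \<in> \<Inter>\<C>\<rbrakk> \<Longrightarrow>
        \<exists>U\<in>clopens X. \<exists>V\<in>clopens X. U \<noteq> {} \<and> V \<noteq> {} \<and> U \<inter> V = {} \<and> U \<subseteq> \<Inter>\<C> \<and> V \<subseteq> \<Inter>\<C>"

text \<open>A point is seen by a finite \<open>F\<close> only through its trace, and there are
  countably many pairs of a finite \<open>F\<close> and a trace on it; one point is kept for each
  pair and each side of \<open>b\<close> that occurs. The set \<open>D\<close> replaces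
  \<open>S\<close> where only countable families are allowed.\<close>

lemma countable_finite_traces:
  fixes R :: "'p set" and S b :: "'s set" and m :: "'s \<Rightarrow> 'p \<Rightarrow> bool"
  assumes "countable R"
  obtains D where "countable D" "D \<subseteq> S"
    "\<And>F s. \<lbrakk>finite F; F \<subseteq> R; s \<in> S\<rbrakk> \<Longrightarrow> \<exists>d\<in>D. (\<forall>p\<in>F. m d p = m s p) \<and> (d \<in> b \<longleftrightarrow> s \<in> b)"
proof -
  define I where "I = {F. finite F \<and> F \<subseteq> R} \<times> {T. finite T \<and> T \<subseteq> R} \<times> (UNIV :: bool set)"
  define Q where "Q i s \<longleftrightarrow> s \<in> S \<and> (case i of (F, T, \<beta>) \<Rightarrow> (\<forall>p\<in>F. m s p \<longleftrightarrow> p \<in> T) \<and> (s \<in> b \<longleftrightarrow> \<beta>))"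
    for i s
  define D where "D = (\<lambda>i. SOME s. Q i s) ` {i \<in> I. \<exists>s. Q i s}"
  have Q: "Q i (SOME s. Q i s)" if "\<exists>s. Q i s" for i using that by (rule someI_ex)
  show thesis
  proof
    have "countable I"
      using assms unfolding I_def by (intro countable_SIGMA countable_Collect_finite_subset) auto
    then show "countable D" unfolding D_def by (intro countable_image) simp
    show "D \<subseteq> S" 
    proof
      fix d assume "d \<in> D"
      then obtain i where "\<exists>s. Q i s" "d = (SOME s. Q i s)" unfolding D_def by blast
      then have "Q i d" using Q by blast
      then show "d \<in> S" by (simp add: Q_def)
    qed
    fix F s assume F: "finite F" "F \<subseteq> R" "s \<in> S"
    define i where "i = (F, {p\<in>F. m s p}, s \<in> b)"
    have "Q i s" "i \<in> I" using F by (auto simp: Q_def I_def i_def)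
    then have "(SOME s. Q i s) \<in> D" "Q i (SOME s. Q i s)" using Q unfolding D_def by blast+
    then show "\<exists>d\<in>D. (\<forall>p\<in>F. m d p = m s p) \<and> (d \<in> b \<longleftrightarrow> s \<in> b)"
      by (intro bexI[of _ "SOME s. Q i s"]) (auto simp: Q_def i_def)
  qed
qed

text \<open>The fibre of a point \<open>s\<close> consists of the points that agree with it; by thickness it contains two
  disjoint nonempty clopen sets \<open>U s\<close> and \<open>V s\<close> that depend only on the fibre.  Forcing \<open>U s\<close> into
  \<open>b'\<close> and \<open>V s\<close> out of it, for countably many \<open>s\<close> inside and outside \<open>b\<close> respectively, guarantees
  that \<open>b'\<close> splits everything that \<open>b\<close> splits.\<close>

lemma matched_extend:
  fixes X :: "'a topology" and Z :: "'b topology"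
  assumes X: "stone_space X" and Z: "parovicenko_space Z"
    and R: "countable R" "matched X Z R" and b: "b \<in> clopens X"
  shows "\<exists>b'. matched X Z (insert (b, b') R)"
proof -
  interpret X: stone_space X by fact
  interpret Z: parovicenko_space Z by fact
  define fibre where "fibre F s = {z \<in> topspace Z. agree F s z}" for F :: "('a set \<times> 'b set) set" and s
  have Rcl: "R \<subseteq> clopens X \<times> clopens Z"
    and RX: "\<And>s. s \<in> topspace X \<Longrightarrow> \<exists>z\<in>topspace Z. agree R s z"
    and RZ: "\<And>z. z \<in> topspace Z \<Longrightarrow> \<exists>s\<in>topspace X. agree R s z"
    using R(2) by (auto simp: matched_def)
  have fibre_Inter: "fibre F s =
      topspace Z \<inter> \<Inter>((\<lambda>p. if s \<in> fst p then snd p else topspace Z - snd p) ` F)" for F s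
    by (auto simp: fibre_def agree_def)
  have cl: "(\<lambda>p. if s \<in> fst p then snd p else topspace Z - snd p) ` F \<subseteq> clopens Z"
    if "F \<subseteq> R" for F s
    using that Rcl by (auto split: prod.split)
  have fibre_clopen: "fibre F s \<in> clopens Z" if "finite F" "F \<subseteq> R" for F s
    unfolding fibre_Inter using that by (intro clopens_finite_Inter cl) auto
  define pair where "pair \<Phi> UV \<longleftrightarrow> (case UV of (U, V) \<Rightarrow> U \<in> clopens Z \<and> V \<in> clopens Z \<and>
      U \<noteq> {} \<and> V \<noteq> {} \<and> U \<inter> V = {} \<and> U \<subseteq> \<Phi> \<and> V \<subseteq> \<Phi>)" for \<Phi> UV
  define UV where "UV \<Phi> = (SOME UV. pair \<Phi> UV)" for \<Phi>
  have UV_ex: "\<exists>UV. pair (fibre R s) UV" if s: "s \<in> topspace X" for s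
  proof -
    let ?\<C> = "insert (topspace Z) ((\<lambda>p. if s \<in> fst p then snd p else topspace Z - snd p) ` R)"
    obtain z where z: "z \<in> topspace Z" "z \<in> fibre R s" using RX[OF s] by (auto simp: fibre_def)
    have eq: "fibre R s = \<Inter>?\<C>" by (simp add: fibre_Inter)
    have C1: "countable ?\<C>" using R(1) by simp
    have C2: "?\<C> \<subseteq> clopens Z" using cl[of R s] by simp
    have C3: "z \<in> \<Inter>?\<C>" using z(2) eq by simp
    obtain U V where "U \<in> clopens Z" "V \<in> clopens Z" "U \<noteq> {}" "V \<noteq> {}"
        "U \<inter> V = {}" "U \<subseteq> \<Inter>?\<C>" "V \<subseteq> \<Inter>?\<C>"
      using Z.thick[OF C1 C2 z(1) C3] by (elim bexE conjE)
    then show ?thesis unfolding pair_def eq by (intro exI[of _ "(U, V)"]) simp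
  qed
  have UV: "pair (fibre R s) (UV (fibre R s))" if "s \<in> topspace X" for s
    unfolding UV_def by (rule someI_ex[OF UV_ex[OF that]])
  define U V where "U s = fst (UV (fibre R s))" and "V s = snd (UV (fibre R s))" for s
  have UVs: "U s \<in> clopens Z" "V s \<in> clopens Z" "U s \<noteq> {}" "V s \<noteq> {}" "U s \<inter> V s = {}"
    "U s \<subseteq> fibre R s" "V s \<subseteq> fibre R s" if "s \<in> topspace X" for s
    using UV[OF that] by (auto simp: pair_def U_def V_def split: prod.splits)
  have UV_disjoint: "U s \<inter> V t = {}" if st: "s \<in> topspace X" "t \<in> topspace X" for s t
  proof (rule ccontr)
    assume "U s \<inter> V t \<noteq> {}"
    then obtain z where "z \<in> fibre R s" "z \<in> fibre R t"
      using UVs(6)[OF st(1)] UVs(7)[OF st(2)] by blast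
    \<comment> \<open>The common point \<open>z\<close> determines the trace of both
      \<open>s\<close> and \<open>t\<close> on all of \<open>R\<close>: fibres are equal or
      disjoint.\<close>
    then have "agree R s z' \<longleftrightarrow> agree R t z'" for z' by (auto simp: fibre_def agree_def)
    then have "fibre R s = fibre R t" by (simp add: fibre_def)
    then have "V t = V s" by (simp add: V_def)
    then show False using UVs(5)[OF st(1)] \<open>U s \<inter> V t \<noteq> {}\<close> by simp
  qed
  obtain D where D: "countable D" "D \<subseteq> topspace X"
    and D': "\<And>F s. \<lbrakk>finite F; F \<subseteq> R; s \<in> topspace X\<rbrakk> \<Longrightarrow>
      \<exists>d\<in>D. (\<forall>p\<in>F. (d \<in> fst p) = (s \<in> fst p)) \<and> (d \<in> b \<longleftrightarrow> s \<in> b)"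
    by (rule countable_finite_traces[OF R(1), of "topspace X" "\<lambda>s p. s \<in> fst p" b]) (rule that)
  have DF: "\<exists>d\<in>D. (\<forall>z. agree F d z \<longleftrightarrow> agree F s z) \<and> (d \<in> b \<longleftrightarrow> s \<in> b)"
    if "finite F" "F \<subseteq> R" "s \<in> topspace X" for F s
  proof -
    from D'[OF that] obtain d where "d \<in> D" "\<forall>p\<in>F. (d \<in> fst p) = (s \<in> fst p)" "d \<in> b \<longleftrightarrow> s \<in> b"
      by blast
    then show ?thesis unfolding agree_def by (intro bexI[of _ d]) auto
  qed
  define I where "I = {F. finite F \<and> F \<subseteq> R} \<times> D"
  have "countable I"
    unfolding I_def using R(1) D(1) by (intro countable_SIGMA countable_Collect_finite_subset) auto
  \<comment> \<open>A finite part of \<open>R\<close> cuts \<open>X\<close> and \<open>Z\<close>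
    into corresponding cells. \<open>side w\<close> collects the cells of \<open>Z\<close> whose
    partners lie inside \<open>w\<close>: a set matching \<open>b\<close> has to contain those for
    \<open>b\<close> and to miss those for its complement. Taking the cells of points of
    \<open>D\<close> keeps the family countable.\<close>
  define side where "side w = (\<lambda>i. fibre (fst i) (snd i)) `
      {i \<in> I. \<forall>s\<in>topspace X. \<forall>z. agree (fst i) (snd i) z \<and> agree (fst i) s z \<longrightarrow> s \<in> w}" for w
  define \<A> where "\<A> = side b \<union> U ` (D \<inter> b)"
  define \<B> where "\<B> = side (topspace X - b) \<union> V ` (D - b)"
  have side: "s \<in> w" if "A \<in> side w" "z \<in> A" "s \<in> topspace X" "agree R s z" for A w z s
  proof -
    from that(1) obtain i where i: "i \<in> I" "A = fibre (fst i) (snd i)"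
      "\<forall>s\<in>topspace X. \<forall>z. agree (fst i) (snd i) z \<and> agree (fst i) s z \<longrightarrow> s \<in> w"
      unfolding side_def by blast
    then have "fst i \<subseteq> R" by (auto simp: I_def)
    then have "agree (fst i) s z" by (rule agree_mono[OF that(4)])
    moreover have "agree (fst i) (snd i) z" using that(2) i(2) by (simp add: fibre_def)
    ultimately show ?thesis using that(3) i(3) by blast
  qed
  have side_countable: "countable (side w)" for w
    unfolding side_def using \<open>countable I\<close> by (intro countable_image) simp
  have side_clopen: "side w \<subseteq> clopens Z" for w
    using fibre_clopen by (auto simp: side_def I_def)
  have "\<exists>C\<in>clopens Z. \<Union>\<A> \<subseteq> C \<and> C \<inter> \<Union>\<B> = {}"
  proof (rule Z.separate)
    show "countable \<A>" "countable \<B>"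
      using side_countable D(1) by (auto simp: \<A>_def \<B>_def)
    show AZ: "\<A> \<subseteq> clopens Z" and BZ: "\<B> \<subseteq> clopens Z"
      using side_clopen UVs(1,2) D(2) by (auto simp: \<A>_def \<B>_def)
    fix A B assume AB: "A \<in> \<A>" "B \<in> \<B>"
    show "A \<inter> B = {}"
    proof (rule ccontr)
      assume "A \<inter> B \<noteq> {}"
      then obtain z where z: "z \<in> A" "z \<in> B" by blast
      then have "z \<in> topspace Z" using clopens_subset[of A Z] AZ AB(1) by blast
      then obtain s where s: "s \<in> topspace X" "agree R s z" using RZ[of z] by blast
      show False
      proof (cases "A \<in> side b")
        case True
        note A = True
        show False
        proof (cases "B \<in> side (topspace X - b)")
          case True
          show False using side[OF A z(1) s] side[OF True z(2) s] by blast
        next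
          case False
          then obtain t where t: "t \<in> D - b" "B = V t" using AB(2) by (auto simp: \<B>_def)
          then have tX: "t \<in> topspace X" using D(2) by blast
          have "agree R t z" using UVs(7)[OF tX] t z(2) by (auto simp: fibre_def)
          then show False using side[OF A z(1) tX] t by blast
        qed
      next
        case False
        then obtain t where t: "t \<in> D \<inter> b" "A = U t" using AB(1) by (auto simp: \<A>_def)
        show False
        proof (cases "B \<in> side (topspace X - b)")
          case True
          have tX: "t \<in> topspace X" using D(2) t by blast
          have "agree R t z" using UVs(6)[OF tX] t z(1) by (auto simp: fibre_def)
          then show False using side[OF True z(2) tX] t by blast
        next
          case False
          then obtain u where "u \<in> D - b" "B = V u" using AB(2) by (auto simp: \<B>_def)
          then show False using UV_disjoint[of t u] t z D(2) by blast
        qed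
      qed
    qed
  qed
  then obtain b' where b': "b' \<in> clopens Z" "\<Union>\<A> \<subseteq> b'" "b' \<inter> \<Union>\<B> = {}"
    by (elim bexE conjE)
  have "matched X Z (insert (b, b') F)" if F: "finite F" "F \<subseteq> R" for F
    unfolding matched_def agree_insert
  proof (intro conjI ballI)
    show "insert (b, b') F \<subseteq> clopens X \<times> clopens Z" using F Rcl b b' by auto
    show "\<exists>z\<in>topspace Z. (s \<in> b \<longleftrightarrow> z \<in> b') \<and> agree F s z" if s: "s \<in> topspace X" for s
    proof -
      \<comment> \<open>Only the trace on the finite \<open>F\<close> matters, so \<open>s\<close>
        may be replaced by a point of \<open>D\<close>, in whose fibre \<open>b'\<close> has been
        forced to have points on both required sides.\<close>
      obtain d where d: "d \<in> D" "\<forall>z. agree F d z \<longleftrightarrow> agree F s z" "d \<in> b \<longleftrightarrow> s \<in> b"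
        using DF[OF F s] by (elim bexE conjE)
      have dX: "d \<in> topspace X" using d D(2) by blast
      have "\<exists>z\<in>fibre R d. s \<in> b \<longleftrightarrow> z \<in> b'"
      proof (cases "s \<in> b")
        case True
        then have "U d \<subseteq> b'" using d b'(2) by (auto simp: \<A>_def)
        then show ?thesis using UVs(3,6)[OF dX] True by blast
      next
        case False
        then have "V d \<inter> b' = {}" using d b'(3) by (auto simp: \<B>_def)
        then show ?thesis using UVs(4,7)[OF dX] False by blast
      qed
      then show ?thesis using d(2) agree_mono[OF _ F(2)] by (auto simp: fibre_def)
    qed
    show "\<exists>s\<in>topspace X. (s \<in> b \<longleftrightarrow> z \<in> b') \<and> agree F s z" if z: "z \<in> topspace Z" for z
    proof -
      obtain t where t: "t \<in> topspace X" "agree R t z" using RZ[OF z] by (elim bexE)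
      obtain d where d: "d \<in> D" "\<forall>z. agree F d z \<longleftrightarrow> agree F t z"
        using DF[OF F t(1)] by (elim bexE conjE)
      have zd: "z \<in> fibre F d" using z t d agree_mono[OF _ F(2)] by (auto simp: fibre_def)
      have dI: "(F, d) \<in> I" using d F by (simp add: I_def)
      have *: "agree F s z" if "agree F d y" "agree F s y" for s y
        using that zd by (auto simp: fibre_def agree_def)
      \<comment> \<open>If no point in the cell of \<open>z\<close> were on the required side of
        \<open>b\<close>, the whole cell would lie on the other side; its fibre would belong to
        \<open>side\<close>, and \<open>b'\<close> would have placed \<open>z\<close> there as
        well.\<close>
      show ?thesis
      proof (rule ccontr)
        assume no: "\<not> ?thesis"
        show False
        proof (cases "z \<in> b'")
          case True
          then have "fibre F d \<in> side (topspace X - b)"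
            unfolding side_def using no dI * by (intro image_eqI[of _ _ "(F, d)"]) auto
          then show False using b'(3) True zd by (auto simp: \<B>_def)
        next
          case False
          then have "fibre F d \<in> side b"
            unfolding side_def using no dI * by (intro image_eqI[of _ _ "(F, d)"]) auto
          then show False using b'(2) False zd by (auto simp: \<A>_def)
        qed
      qed
    qed
  qed
  then have "matched X Z F" if "finite F" "F \<subseteq> insert (b, b') R" for F
    using that matched_mono[of X Z "insert (b, b') (F - {(b, b')})" F] by (metis finite_Diff
      insert_Diff_single subset_insertI subset_insert_iff)
  then show ?thesis
    using matched_compactness[OF X Z.stone_space_axioms] by blast
qed

section \<open>Parovichenko's theorem\<close>

lemma continuous_map_clopens:
  assumes "stone_space Z" "f \<in> topspace X \<rightarrow> topspace Z"
    and "\<And>C. C \<in> clopens Z \<Longrightarrow> openin X {s \<in> topspace X. f s \<in> C}"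
  shows "continuous_map X Z f"
  unfolding continuous_map_def
proof (intro conjI allI impI)
  fix W assume W: "openin Z W"
  show "openin X {s \<in> topspace X. f s \<in> W}"
    unfolding openin_subopen[of _ "{s \<in> topspace X. f s \<in> W}"]
  proof
    fix s assume s: "s \<in> {s \<in> topspace X. f s \<in> W}"
    then have "f s \<in> W" by simp
    from stone_space.clopen_neighbourhood[OF assms(1) W this]
    obtain C where "C \<in> clopens Z" "f s \<in> C" "C \<subseteq> W" by blast
    then show "\<exists>T. openin X T \<and> s \<in> T \<and> T \<subseteq> {s \<in> topspace X. f s \<in> W}"
      using s assms(3)[of C] by (intro exI[of _ "{s \<in> topspace X. f s \<in> C}"]) auto
  qed
qed (use assms(2) in auto)

lemma agree_unique:
  assumes "stone_space Z" "clopens Z \<subseteq> snd ` R"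
    and "z \<in> topspace Z" "z' \<in> topspace Z" "agree R s z" "agree R s z'"
  shows "z = z'"
proof (rule ccontr)
  assume "z \<noteq> z'"
  from stone_space.clopen_points[OF assms(1,3,4) this]
  obtain C where C: "C \<in> clopens Z" "z \<in> C" "z' \<notin> C" by blast
  then obtain p where "p \<in> R" "snd p = C" using assms(2) by (metis imageE subsetD)
  then show False using assms(5,6) C unfolding agree_def by metis
qed

lemma agree_continuous:
  assumes "stone_space Z" "matched X Z R" "clopens Z \<subseteq> snd ` R"
    and f: "\<And>s. s \<in> topspace X \<Longrightarrow> f s \<in> topspace Z \<and> agree R s (f s)"
  shows "continuous_map X Z f"
proof (rule continuous_map_clopens[OF assms(1)])
  show "f \<in> topspace X \<rightarrow> topspace Z" using f by blast
  fix C assume "C \<in> clopens Z"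
  then obtain p where p: "p \<in> R" "snd p = C" using assms(3) by (metis imageE subsetD)
  then have "fst p \<in> clopens X" using assms(2) by (auto simp: matched_def)
  moreover have "{s \<in> topspace X. f s \<in> C} = fst p"
    using f p clopens_subset[OF calculation] unfolding agree_def by blast
  ultimately show "openin X {s \<in> topspace X. f s \<in> C}" by (simp add: clopens_openin)
qed

text \<open>Stone duality in terms of points: once every clopen set occurs in \<open>R\<close>,
  agreement determines each point from its partner, so it is the graph of a bijection. The preimage
  of a clopen set is its partner in \<open>R\<close>, whence continuity both ways.\<close>

lemma matched_imp_homeomorphic:
  assumes X: "stone_space X" and Z: "stone_space Z" and R: "matched X Z R"
    and total: "clopens X \<subseteq> fst ` R" "clopens Z \<subseteq> snd ` R"
  shows "X homeomorphic_space Z"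
proof -
  have "\<forall>s\<in>topspace X. \<exists>z. z \<in> topspace Z \<and> agree R s z"
    using R unfolding matched_def by blast
  then obtain f where f: "\<forall>s\<in>topspace X. f s \<in> topspace Z \<and> agree R s (f s)"
    unfolding bchoice_iff by (rule exE)
  have "\<forall>z\<in>topspace Z. \<exists>s. s \<in> topspace X \<and> agree R s z"
    using R unfolding matched_def by blast
  then obtain g where g: "\<forall>z\<in>topspace Z. g z \<in> topspace X \<and> agree R (g z) z"
    unfolding bchoice_iff by (rule exE)
  have total': "clopens X \<subseteq> snd ` (R\<inverse>)" using total(1) by force
  have "continuous_map X Z f" using f by (intro agree_continuous[OF Z R total(2)]) blast
  moreover have "continuous_map Z X g"
    by (rule agree_continuous[OF X matched_converse[OF R] total'])
      (use g in \<open>auto simp: agree_converse\<close>)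
  moreover have "f (g z) = z" if z: "z \<in> topspace Z" for z
    using z f g by (intro agree_unique[OF Z total(2), of _ _ "g z"]) auto
  moreover have "g (f s) = s" if s: "s \<in> topspace X" for s
    using s f g by (intro agree_unique[OF X total', of _ _ "f s"]) (auto simp: agree_converse)
  ultimately show ?thesis unfolding homeomorphic_space_def homeomorphic_maps_def by blast
qed

text \<open>The reals are ordered in the type of their cardinal. A proper initial segment then has
  smaller cardinality than the continuum, hence is countable by hypothesis. Removing the diagonal
  makes the order strict.\<close>

lemma continuum_hypothesis_well_order:
  assumes continuum_hypothesis
  obtains r :: "real rel" where "wf r" "trans r" "total r" "\<And>x. countable {y. (y, x) \<in> r}"
proof -
  define r where "r = card_of (UNIV :: real set)"
  have wo: "well_order_on UNIV r" unfolding r_def by (rule card_of_well_order_on)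
  have "countable (underS r x)" for x
  proof (rule ccontr)
    assume "uncountable (underS r x)"
    then have "underS r x \<approx> (UNIV :: real set)"
      using assms by (simp add: continuum_hypothesis_def)
    then have "ordIso2 (card_of (underS r x)) r" by (simp add: eqpoll_iff_card_of_ordIso r_def)
    moreover have "ordLess2 (card_of (underS r x)) r"
      using card_of_underS[OF card_of_Card_order, of x UNIV] by (simp add: r_def Field_card_of)
    ultimately show False using not_ordLess_ordIso by blast
  qed
  moreover have "{y. (y, x) \<in> r - Id} = underS r x" for x by (auto simp: underS_def)
  moreover have "wf (r - Id)" "trans (r - Id)" "total (r - Id)"
    using wo trans_diff_Id
    by (auto simp: well_order_on_def linear_order_on_def partial_order_on_def preorder_on_def)
  ultimately show thesis using that[of "r - Id"] by simp
qed

lemma finite_has_greatest: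
  assumes "trans r" "total r" "finite J" "J \<noteq> {}"
  shows "\<exists>j\<in>J. \<forall>k\<in>J. k = j \<or> (k, j) \<in> r"
  using assms(3,4)
proof (induction rule: finite_ne_induct)
  case (insert i J)
  then obtain j where j: "j \<in> J" "\<forall>k\<in>J. k = j \<or> (k, j) \<in> r" by blast
  show ?case
  proof (cases "(i, j) \<in> r \<or> i = j")
    case False
    then have "(j, i) \<in> r" using assms(2) by (auto simp: total_on_def)
    then have "\<forall>k\<in>J. (k, i) \<in> r" using j(2) transD[OF assms(1)] by metis
    then show ?thesis by blast
  qed (use j in blast)
qed simp

text \<open>The back-and-forth recursion, freed of topology: the reals are at once the stages and
  the requirements \<open>Q t\<close> to be met. Countable initial segments ensure that
  \<open>extend\<close> is only ever applied to a countable relation.\<close>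

lemma transfinite_completion:
  fixes P :: "'p set \<Rightarrow> bool" and Q :: "real \<Rightarrow> 'p \<Rightarrow> bool"
  assumes "continuum_hypothesis" "P {}"
    and mono: "\<And>R F. P R \<Longrightarrow> F \<subseteq> R \<Longrightarrow> P F"
    and finitary: "\<And>R. (\<And>F. finite F \<Longrightarrow> F \<subseteq> R \<Longrightarrow> P F) \<Longrightarrow> P R"
    and extend: "\<And>R t. countable R \<Longrightarrow> P R \<Longrightarrow> \<exists>p. Q t p \<and> P (insert p R)"
  shows "\<exists>R. P R \<and> (\<forall>t. \<exists>p\<in>R. Q t p)"
proof -
  obtain r :: "real rel" where r: "wf r" "trans r" "total r" "\<And>x. countable {y. (y, x) \<in> r}"
    by (rule continuum_hypothesis_well_order[OF assms(1)]) (rule that)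
  \<comment> \<open>A finite part of a union of stages has a greatest index and already lies in that
    stage; finite character does the rest, so no separate limit clause is needed.\<close>
  have union: "P (f ` I)" if f: "\<And>i. i \<in> I \<Longrightarrow> P (insert (f i) (f ` {j. (j, i) \<in> r}))"
    for I and f :: "real \<Rightarrow> 'p"
  proof (rule finitary)
    fix F assume "finite F" "F \<subseteq> f ` I"
    then obtain J where J: "J \<subseteq> I" "finite J" "F = f ` J" by (meson finite_subset_image)
    show "P F"
    proof (cases "J = {}")
      case False
      from finite_has_greatest[OF r(2,3) J(2) this]
      obtain j where j: "j \<in> J" "\<forall>k\<in>J. k = j \<or> (k, j) \<in> r" by blast
      show ?thesis
      proof (rule mono[OF f])
        show "j \<in> I" using J(1) j(1) by blast
        show "F \<subseteq> insert (f j) (f ` {k. (k, j) \<in> r})" using J(3) j(2) by auto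
      qed
    qed (use J assms(2) in simp)
  qed
  have "\<exists>f. \<forall>i. Q i (f i) \<and> P (insert (f i) (f ` {j. (j, i) \<in> r}))"
  proof (rule dependent_wf_choice[OF r(1)])
    fix f g :: "real \<Rightarrow> 'p" and i p
    assume "\<And>j. (j, i) \<in> r \<Longrightarrow> f j = g j"
    then have "f ` {j. (j, i) \<in> r} = g ` {j. (j, i) \<in> r}" by (intro image_cong) auto
    then show "(Q i p \<and> P (insert p (f ` {j. (j, i) \<in> r}))) =
        (Q i p \<and> P (insert p (g ` {j. (j, i) \<in> r})))" by simp
  next
    fix i and f :: "real \<Rightarrow> 'p"
    assume "\<And>j. (j, i) \<in> r \<Longrightarrow> Q j (f j) \<and> P (insert (f j) (f ` {k. (k, j) \<in> r}))"
    then have "P (f ` {j. (j, i) \<in> r})" by (intro union) auto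
    then show "\<exists>p. Q i p \<and> P (insert p (f ` {j. (j, i) \<in> r}))"
      by (rule extend[OF countable_image[OF r(4)]])
  qed
  then obtain f where f: "\<And>i. Q i (f i) \<and> P (insert (f i) (f ` {j. (j, i) \<in> r}))" by blast
  then have "P (range f)" by (intro union) blast
  then show ?thesis using f by blast
qed

theorem parovicenko:
  fixes X :: "'a topology" and Z :: "'b topology"
  assumes "continuum_hypothesis" and X: "parovicenko_space X" and Z: "parovicenko_space Z"
  shows "X homeomorphic_space Z"
proof -
  interpret X: parovicenko_space X by fact
  interpret Z: parovicenko_space Z by fact
  obtain gX where gX: "clopens X \<subseteq> gX ` (UNIV :: real set)"
    using X.few_clopens unfolding lepoll_iff by (rule exE)
  obtain gZ where gZ: "clopens Z \<subseteq> gZ ` (UNIV :: real set)"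
    using Z.few_clopens unfolding lepoll_iff by (rule exE)
  \<comment> \<open>The enumeration may also name sets that are not clopen. The requirement is then
    void, and matching the empty set supplies the pair that the recursion still asks for.\<close>
  have fwd: "\<exists>p. (C \<in> clopens X \<longrightarrow> C = fst p) \<and> matched X Z (insert p R)"
    if "countable R" "matched X Z R" for C and R :: "('a set \<times> 'b set) set"
  proof (cases "C \<in> clopens X")
    case True
    from matched_extend[OF X.stone_space_axioms Z that True] show ?thesis by (metis fst_conv)
  next
    case False
    from matched_extend[OF X.stone_space_axioms Z that clopens_empty] show ?thesis
      using False by blast
  qed
  have conv: "\<exists>p. (C \<in> clopens Z \<longrightarrow> C = snd p) \<and> matched X Z (insert p R)"
    if R: "countable R" "matched X Z R" for C and R :: "('a set \<times> 'b set) set"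
  proof -
    define B where "B = (if C \<in> clopens Z then C else {})"
    have "B \<in> clopens Z" by (simp add: B_def)
    moreover have "R\<inverse> = prod.swap ` R" by force
    then have "countable (R\<inverse>)" using R(1) by simp
    moreover have "matched Z X (R\<inverse>)" using R(2) by (rule matched_converse)
    ultimately obtain a where "matched Z X (insert (B, a) (R\<inverse>))"
      using matched_extend[OF Z.stone_space_axioms X] by blast
    then have "matched X Z ((insert (B, a) (R\<inverse>))\<inverse>)" by (rule matched_converse)
    also have "(insert (B, a) (R\<inverse>))\<inverse> = insert (a, B) R" by auto
    finally show ?thesis by (intro exI[of _ "(a, B)"]) (simp add: B_def)
  qed
  \<comment> \<open>One index set serves both directions: \<open>ln\<close> maps the positive reals
    onto all reals, so positive \<open>t\<close> run through the clopen sets of \<open>X\<close> and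
    negative \<open>t\<close> through those of \<open>Z\<close>. The value at 0 only adds a harmless
    requirement.\<close>
  define Q where "Q t p \<longleftrightarrow> (if t > 0 then gX (ln t) \<in> clopens X \<longrightarrow> gX (ln t) = fst p
      else gZ (ln (- t)) \<in> clopens Z \<longrightarrow> gZ (ln (- t)) = snd p)" for t and p :: "'a set \<times> 'b set"
  have "\<exists>R. matched X Z R \<and> (\<forall>t. \<exists>p\<in>R. Q t p)"
  proof (rule transfinite_completion[OF assms(1)])
    show "matched X Z {}"
      using X.nonempty Z.nonempty unfolding matched_def agree_def by blast
    show "matched X Z F" if "matched X Z R" "F \<subseteq> R" for R F
      using that by (rule matched_mono)
    show "matched X Z R" if "\<And>F. finite F \<Longrightarrow> F \<subseteq> R \<Longrightarrow> matched X Z F" for R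
      using that by (rule matched_compactness[OF X.stone_space_axioms Z.stone_space_axioms])
    show "\<exists>p. Q t p \<and> matched X Z (insert p R)" if "countable R" "matched X Z R" for R t
      using fwd[OF that, of "gX (ln t)"] conv[OF that, of "gZ (ln (- t))"]
      unfolding Q_def by (cases "t > 0") (simp_all only: if_True if_False)
  qed
  then obtain R where R: "matched X Z R" "\<forall>t. \<exists>p\<in>R. Q t p" by blast
  show ?thesis
  proof (rule matched_imp_homeomorphic[OF X.stone_space_axioms Z.stone_space_axioms R(1)])
    show "clopens X \<subseteq> fst ` R"
    proof
      fix C assume C: "C \<in> clopens X"
      then obtain u where u: "C = gX u" using gX by blast
      obtain p where "p \<in> R" "Q (exp u) p" using R(2) by blast
      then show "C \<in> fst ` R" using C u by (auto simp: Q_def)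
    qed
    show "clopens Z \<subseteq> snd ` R"
    proof
      fix C assume C: "C \<in> clopens Z"
      then obtain u where u: "C = gZ u" using gZ by blast
      obtain p where "p \<in> R" "Q (- exp u) p" using R(2) by blast
      then show "C \<in> snd ` R" using C u by (auto simp: Q_def)
    qed
  qed
qed

section \<open>The remainder of the natural numbers\<close>

lemma topspace_omega_star:
  "topspace omega_star = {F. ultrafilter F \<and> (\<forall>n. F \<noteq> principal {n})}"
  by (auto simp: omega_star_def topspace_beta_omega)

text \<open>An ultrafilter containing a singleton is principal. A free one therefore contains every
  cofinite set.\<close>

lemma omega_star_finite:
  assumes "F \<in> topspace omega_star" "finite A"
  shows "\<not> eventually (\<lambda>n. n \<in> A) F"
proof
  assume "eventually (\<lambda>n. n \<in> A) F"
  have F: "ultrafilter F" "\<And>n. F \<noteq> principal {n}"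
    using assms(1) by (auto simp: topspace_omega_star)
  have "eventually (\<lambda>m. m \<noteq> n) F" for n
  proof (rule ccontr)
    assume "\<not> eventually (\<lambda>m. m \<noteq> n) F"
    then have n: "eventually (\<lambda>m. m = n) F"
      using ultrafilter_not_iff[OF F(1), of "\<lambda>m. m \<noteq> n"] by simp
    have "eventually P F \<longleftrightarrow> P n" for P
    proof
      assume "eventually P F"
      with n have "eventually (\<lambda>m. P n) F" by eventually_elim auto
      then show "P n" using F(1) by (auto simp: ultrafilter_def eventually_const)
    next
      assume "P n"
      then show "eventually P F" using n by (auto elim: eventually_mono)
    qed
    then have "F = principal {n}" by (simp add: filter_eq_iff eventually_principal)
    with F(2) show False by blast
  qed
  then have "eventually (\<lambda>m. \<forall>n\<in>A. m \<noteq> n) F"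
    using assms(2) by (simp add: eventually_ball_finite)
  with \<open>eventually (\<lambda>n. n \<in> A) F\<close> have "eventually (\<lambda>m. False) F"
    by eventually_elim auto
  then show False using F(1) by (simp add: ultrafilter_def)
qed

text \<open>The trace on the remainder of the closure of \<open>A\<close> in
  \<open>beta_omega\<close>. By \<open>star_subset_iff\<close> these sets form a copy of the power
  set of omega modulo finite sets.\<close>

definition star :: "nat set \<Rightarrow> nat filter set" where
  "star A = {F \<in> topspace omega_star. eventually (\<lambda>n. n \<in> A) F}"

lemma star_UNIV: "star UNIV = topspace omega_star"
  by (simp add: star_def)

lemma star_Int: "star (A \<inter> B) = star A \<inter> star B"
  by (auto simp: star_def eventually_conj_iff)

lemma star_Compl: "star (- A) = topspace omega_star - star A"
  by (auto simp: star_def topspace_omega_star ultrafilter_not_iff)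

lemma star_Diff: "star (A - B) = star A - star B"
  using star_Int[of A "- B"] star_Compl[of B] by (auto simp: Diff_eq star_def)

lemma star_Un: "star (A \<union> B) = star A \<union> star B"
proof -
  have "star (- (A \<union> B)) = star (- A) \<inter> star (- B)" by (simp add: star_Int)
  then show ?thesis unfolding star_Compl by (auto simp: star_def)
qed

lemma star_empty_iff: "star A = {} \<longleftrightarrow> finite A"
proof
  assume "star A = {}"
  show "finite A"
  proof (rule ccontr)
    assume "infinite A"
    have "inf cofinite (principal A) \<noteq> bot"
    \<comment> \<open>For infinite \<open>A\<close> the cofinite filter restricted to
      \<open>A\<close> is proper; an ultrafilter below it is free and contains
      \<open>A\<close>.\<close>
    proof
      assume "inf cofinite (principal A) = bot"
      then have "eventually (\<lambda>x. False) (inf cofinite (principal A))" by simp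
      then have "finite {x. \<not> (x \<in> A \<longrightarrow> False)}"
        unfolding eventually_inf_principal eventually_cofinite .
      with \<open>infinite A\<close> show False by simp
    qed
    then obtain F where F: "ultrafilter F" "F \<le> inf cofinite (principal A)"
      by (rule ultrafilter_exists)
    have "F \<noteq> principal {n}" for n
    proof
      assume "F = principal {n}"
      moreover have "eventually (\<lambda>m. m \<noteq> n) cofinite" by (simp add: eventually_cofinite)
      moreover have "F \<le> cofinite" using F(2) by simp
      ultimately show False using filter_leD[of F cofinite "\<lambda>m. m \<noteq> n"]
        by (simp add: eventually_principal)
    qed
    moreover have "eventually (\<lambda>n. n \<in> A) F" using F(2) by (simp add: le_principal)
    ultimately have "F \<in> star A" using F(1) by (simp add: star_def topspace_omega_star)
    with \<open>star A = {}\<close> show False by blast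
  qed
next
  assume "finite A"
  then show "star A = {}" using omega_star_finite by (auto simp: star_def)
qed

lemma star_subset_iff: "star A \<subseteq> star B \<longleftrightarrow> finite (A - B)"
  using star_empty_iff[of "A - B"] by (auto simp: star_Diff)

lemma star_clopen: "star A \<in> clopens omega_star"
proof -
  have "openin omega_star (star A)" for A
  proof -
    have "star A = {F. ultrafilter F \<and> eventually (\<lambda>n. n \<in> A) F}
        \<inter> (topspace beta_omega - range (\<lambda>n. principal {n}))"
      by (auto simp: star_def topspace_omega_star topspace_beta_omega)
    then show ?thesis
      unfolding omega_star_def openin_subtopology using openin_beta_omega_basic[of A] by blast
  qed
  then have "openin omega_star (star A)" "openin omega_star (topspace omega_star - star A)"
    by (simp_all flip: star_Compl)
  then show ?thesis by (auto simp: clopens_def closedin_def star_def)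
qed

lemma openin_omega_star_base:
  assumes "openin omega_star W" "F \<in> W"
  shows "\<exists>A. F \<in> star A \<and> star A \<subseteq> W"
proof -
  obtain T where T: "openin beta_omega T"
    "W = T \<inter> (topspace beta_omega - range (\<lambda>n. principal {n}))"
    using assms(1) unfolding omega_star_def openin_subtopology by blast
  then have "F \<in> T" using assms(2) by blast
  then obtain A where A: "eventually (\<lambda>n. n \<in> A) F"
      "{G. ultrafilter G \<and> eventually (\<lambda>n. n \<in> A) G} \<subseteq> T"
    using T(1) unfolding openin_beta_omega_iff by blast
  then have "F \<in> star A" using assms openin_subset by (fastforce simp: star_def)
  moreover have "star A \<subseteq> W"
    using A(2) T(2) by (auto simp: star_def topspace_omega_star topspace_beta_omega)
  ultimately show ?thesis by blast
qed

lemma stone_space_omega_star: "stone_space omega_star"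
proof
  \<comment> \<open>Natural numbers are isolated points of \<open>beta_omega\<close>: an ultrafilter
    containing \<open>{n}\<close> is principal. Hence the remainder is closed, and so
    compact.\<close>
  have "openin beta_omega (range (\<lambda>n. principal {n}))"
    unfolding openin_subopen[of _ "range (\<lambda>n::nat. principal {n})"]
  proof
    fix F :: "nat filter" assume F: "F \<in> range (\<lambda>n. principal {n})"
    then obtain n where n: "F = principal {n}" by blast
    let ?T = "{G. ultrafilter G \<and> eventually (\<lambda>m. m \<in> {n}) G}"
    have "?T \<subseteq> range (\<lambda>n. principal {n})"
    proof
      fix G assume G: "G \<in> ?T"
      show "G \<in> range (\<lambda>n. principal {n})"
      proof (rule ccontr)
        assume "G \<notin> range (\<lambda>n. principal {n})"
        then have "G \<in> topspace omega_star" using G by (auto simp: topspace_omega_star)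
        then show False using omega_star_finite[of G "{n}"] G by simp
      qed
    qed
    then show "\<exists>T. openin beta_omega T \<and> F \<in> T \<and> T \<subseteq> range (\<lambda>n. principal {n})"
      using openin_beta_omega_basic[of "{n}"] n ultrafilter_principal[of n]
      by (intro exI[of _ ?T]) (simp add: eventually_principal)
  qed
  then have "closedin beta_omega (topspace beta_omega - range (\<lambda>n. principal {n}))"
    by blast
  then show "compact_space omega_star"
    unfolding omega_star_def
    by (intro compact_space_subtopology closedin_compact_space compact_space_beta_omega)
  fix F G assume FG: "F \<in> topspace omega_star" "G \<in> topspace omega_star" "F \<noteq> G"
  then obtain P where P: "eventually P F \<noteq> eventually P G" by (auto simp: filter_eq_iff)
  then obtain A where A: "F \<in> star A" "G \<notin> star A"
  proof (cases "eventually P F")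
    case True
    then show ?thesis using that[of "{n. P n}"] FG P by (simp add: star_def)
  next
    case False
    then show ?thesis using that[of "- {n. P n}"] FG P
      unfolding star_Compl by (simp add: star_def)
  qed
  then show "\<exists>C\<in>clopens omega_star. F \<in> C \<and> G \<notin> C"
    by (intro bexI[OF _ star_clopen[of A]] conjI)
qed

text \<open>The sets \<open>star A\<close> form a base, so compactness makes a clopen set a finite
  union of them, and such unions are again of the form \<open>star A\<close>.\<close>

lemma clopens_omega_star: "clopens omega_star = range star"
proof
  show "clopens omega_star \<subseteq> range star"
  proof
    fix C assume C: "C \<in> clopens omega_star"
    have 1: "C \<subseteq> \<Union>{D \<in> range star. D \<subseteq> C}"
      using openin_omega_star_base[OF clopens_openin[OF C]] by blast
    have 2: "{D \<in> range star. D \<subseteq> C} \<subseteq> clopens omega_star"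
      using star_clopen by blast
    obtain \<F> where \<F>: "finite \<F>" "\<F> \<subseteq> {D \<in> range star. D \<subseteq> C}" "C \<subseteq> \<Union>\<F>"
      using stone_space.clopens_cover[OF stone_space_omega_star clopens_closedin[OF C] 2 1]
      by (elim exE conjE)
    have "\<Union>\<F> \<in> range star" if "finite \<F>" "\<F> \<subseteq> range star" for \<F>
      using that
    proof (induction rule: finite_induct)
      case empty
      then show ?case using star_empty_iff[of "{}"] by auto
    next
      case (insert D \<F>)
      then obtain A B where "D = star A" "\<Union>\<F> = star B" by blast
      then show ?case using star_Un[of A B] by auto
    qed
    then have "\<Union>\<F> \<in> range star" using \<F> by blast
    moreover have "\<Union>\<F> = C" using \<F> by blast
    ultimately show "C \<in> range star" by simp
  qed
qed (use star_clopen in blast)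

text \<open>There are no gaps between countable families modulo finite sets. Only the
  \<open>B m\<close> with \<open>m \<le> n\<close> are deleted from \<open>A n\<close>, which costs
  \<open>A n\<close> finitely many elements; conversely, \<open>B n\<close> can meet only the
  contributions of \<open>A m\<close> with \<open>m < n\<close>.\<close>

lemma almost_separated:
  fixes A B :: "nat \<Rightarrow> nat set"
  assumes "\<And>m n. finite (A m \<inter> B n)"
  obtains C where "\<And>n. finite (A n - C)" "\<And>n. finite (B n \<inter> C)"
proof -
  define C where "C = (\<Union>n. A n - (\<Union>m\<le>n. B m))"
  have "finite (A n - C)" for n
  proof (rule finite_subset)
    show "A n - C \<subseteq> (\<Union>m\<le>n. A n \<inter> B m)" by (auto simp: C_def)
  qed (intro finite_UN_I assms finite_atMost)
  moreover have "finite (B n \<inter> C)" for n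
  proof (rule finite_subset)
    show "B n \<inter> C \<subseteq> (\<Union>m<n. A m \<inter> B n)" by (force simp: C_def not_le[symmetric])
  qed (intro finite_UN_I assms finite_lessThan)
  ultimately show thesis by (rule that)
qed

text \<open>A strictly increasing sequence with its \<open>n\<close>-th term in the first
  \<open>n + 1\<close> sets is almost contained in each of them; its even and odd terms give the two
  disjoint sets needed for \<open>thick\<close>.\<close>

lemma two_pseudointersections:
  fixes A :: "nat \<Rightarrow> nat set"
  assumes "\<And>n. infinite (\<Inter>i\<le>n. A i)"
  obtains P Q where "infinite P" "infinite Q" "P \<inter> Q = {}"
    "\<And>n. finite (P - A n)" "\<And>n. finite (Q - A n)"
proof -
  have "\<exists>p. \<forall>n. p n \<in> (\<Inter>i\<le>n. A i) \<and> p n < p (Suc n)"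
  proof (rule dependent_nat_choice)
    show "\<exists>x. x \<in> (\<Inter>i\<le>0. A i)" using infinite_imp_nonempty[OF assms[of 0]] by (rule ex_in_conv[THEN iffD2])
    show "\<exists>y. y \<in> (\<Inter>i\<le>Suc n. A i) \<and> x < y" for x n
    proof -
      have "\<exists>y>x. y \<in> (\<Inter>i\<le>Suc n. A i)"
        using assms[of "Suc n"] unfolding infinite_nat_iff_unbounded by (rule spec)
      then show ?thesis by (elim exE conjE, intro exI conjI)
    qed
  qed
  then obtain p where p: "\<And>n. p n \<in> (\<Inter>i\<le>n. A i)" "\<And>n. p n < p (Suc n)" by blast
  have mono: "strict_mono p" using p(2) by (simp add: strict_mono_Suc_iff)
  then have inj: "p i = p j \<longleftrightarrow> i = j" for i j by (rule strict_mono_eq)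
  show thesis
  proof
    have "inj (\<lambda>n. p (2 * n))" "inj (\<lambda>n. p (Suc (2 * n)))"
      by (simp_all add: inj_on_def inj)
    then show "infinite (range (\<lambda>n. p (2 * n)))" "infinite (range (\<lambda>n. p (Suc (2 * n))))"
      by (simp_all add: finite_image_iff)
    show "range (\<lambda>n. p (2 * n)) \<inter> range (\<lambda>n. p (Suc (2 * n))) = {}"
    proof -
      have "2 * i \<noteq> Suc (2 * j)" for i j :: nat by presburger
      then show ?thesis by (auto simp: inj)
    qed
    have *: "range p - A n \<subseteq> p ` {..<n}" for n
    proof
      fix x assume "x \<in> range p - A n"
      then obtain m where m: "x = p m" "p m \<notin> A n" by blast
      then have "m < n" using p(1)[of m] by (meson INT_E atMost_iff not_less)
      then show "x \<in> p ` {..<n}" using m by blast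
    qed
    show "finite (range (\<lambda>n. p (2 * n)) - A n)" for n
      by (rule finite_subset[OF _ finite_imageI[OF finite_lessThan]]) (use *[of n] in blast)
    show "finite (range (\<lambda>n. p (Suc (2 * n))) - A n)" for n
      by (rule finite_subset[OF _ finite_imageI[OF finite_lessThan]]) (use *[of n] in blast)
  qed
qed

text \<open>Adding \<open>C\<close> makes the family nonempty, so that it can be enumerated. In the
  applications \<open>C\<close> is neutral: the empty set for unions, the whole space for
  intersections.\<close>

lemma countable_clopens_omega_star:
  assumes "countable \<A>" "\<A> \<subseteq> clopens omega_star" "C \<in> clopens omega_star"
  obtains A where "insert C \<A> = range (\<lambda>n::nat. star (A n))"
proof -
  have range: "range (from_nat_into (insert C \<A>)) = insert C \<A>"
    using assms(1) by (intro range_from_nat_into) auto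
  have "\<exists>A. from_nat_into (insert C \<A>) n = star A" for n
    using assms(2,3) from_nat_into[of "insert C \<A>" n] unfolding clopens_omega_star by blast
  then obtain A where "\<And>n. from_nat_into (insert C \<A>) n = star (A n)" by metis
  then have "from_nat_into (insert C \<A>) = (\<lambda>n. star (A n))" by (rule ext)
  then show thesis using that[of A] range by simp
qed

lemma parovicenko_space_omega_star: "parovicenko_space omega_star"
proof (intro parovicenko_space.intro parovicenko_space_axioms.intro stone_space_omega_star)
  show "topspace omega_star \<noteq> {}" using star_empty_iff[of UNIV] by (simp add: star_UNIV)
  show "clopens omega_star \<lesssim> (UNIV :: real set)"
    unfolding clopens_omega_star by (rule lepoll_trans2[OF image_lepoll nat_sets_eqpoll_reals])
next
  fix \<A> \<B> assume AB: "countable \<A>" "countable \<B>" "\<A> \<subseteq> clopens omega_star" "\<B> \<subseteq> clopens omega_star"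
    and disj: "\<And>A B. A \<in> \<A> \<Longrightarrow> B \<in> \<B> \<Longrightarrow> A \<inter> B = {}"
  obtain A where A: "insert {} \<A> = range (\<lambda>n::nat. star (A n))"
    using countable_clopens_omega_star[OF AB(1,3) clopens_empty] .
  obtain B where B: "insert {} \<B> = range (\<lambda>n::nat. star (B n))"
    using countable_clopens_omega_star[OF AB(2,4) clopens_empty] .
  have "finite (A m \<inter> B n)" for m n
  proof -
    have "star (A m) \<in> insert {} \<A>" "star (B n) \<in> insert {} \<B>" using A B by auto
    then have "star (A m) \<inter> star (B n) = {}" using disj by auto
    then show ?thesis using star_empty_iff by (simp flip: star_Int)
  qed
  then obtain C where C: "\<And>n. finite (A n - C)" "\<And>n. finite (B n \<inter> C)"
    using almost_separated[of A B] by metis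
  have "D \<subseteq> star C" if "D \<in> \<A>" for D
  proof -
    have "D \<in> range (\<lambda>n. star (A n))" using that by (simp flip: A)
    then obtain n where "D = star (A n)" by blast
    then show ?thesis using C(1)[of n] by (simp add: star_subset_iff)
  qed
  moreover have "star C \<inter> D = {}" if "D \<in> \<B>" for D
  proof -
    have "D \<in> range (\<lambda>n. star (B n))" using that by (simp flip: B)
    then obtain n where "D = star (B n)" by blast
    then show ?thesis using C(2)[of n] by (simp add: star_empty_iff Int_commute flip: star_Int)
  qed
  ultimately show "\<exists>C\<in>clopens omega_star. \<Union>\<A> \<subseteq> C \<and> C \<inter> \<Union>\<B> = {}"
    by (intro bexI[OF _ star_clopen[of C]]) blast
next
  fix \<C> F assume \<C>: "countable \<C>" "\<C> \<subseteq> clopens omega_star" "F \<in> topspace omega_star" "F \<in> \<Inter>\<C>"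
  obtain A where A: "insert (topspace omega_star) \<C> = range (\<lambda>n::nat. star (A n))"
    using countable_clopens_omega_star[OF \<C>(1,2) clopens_topspace] .
  have F: "F \<in> star (A n)" for n
  proof -
    have "star (A n) \<in> insert (topspace omega_star) \<C>" using A by auto
    then show ?thesis using \<C>(3,4) by auto
  qed
  have "infinite (\<Inter>i\<le>n. A i)" for n
  proof -
    have "F \<in> star (\<Inter>i\<le>n. A i)"
    proof (induction n)
      case (Suc n)
      then show ?case using F[of "Suc n"] by (simp add: atMost_Suc star_Int)
    qed (use F[of 0] in simp)
    then show ?thesis using star_empty_iff[of "\<Inter>i\<le>n. A i"] by auto
  qed
  then obtain P Q where PQ: "infinite P" "infinite Q" "P \<inter> Q = {}"
    "\<And>n. finite (P - A n)" "\<And>n. finite (Q - A n)"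
    using two_pseudointersections[of A] by metis
  have "star P \<subseteq> D \<and> star Q \<subseteq> D" if "D \<in> \<C>" for D
  proof -
    have "D \<in> range (\<lambda>n. star (A n))" using that by (simp flip: A)
    then obtain n where "D = star (A n)" by blast
    then show ?thesis using PQ(4,5)[of n] by (simp add: star_subset_iff)
  qed
  then have "star P \<subseteq> \<Inter>\<C>" "star Q \<subseteq> \<Inter>\<C>" by (simp_all add: Inter_greatest)
  moreover have "star P \<noteq> {}" "star Q \<noteq> {}" "star P \<inter> star Q = {}"
    using PQ by (simp_all add: star_empty_iff flip: star_Int)
  ultimately show "\<exists>U\<in>clopens omega_star. \<exists>V\<in>clopens omega_star.
      U \<noteq> {} \<and> V \<noteq> {} \<and> U \<inter> V = {} \<and> U \<subseteq> \<Inter>\<C> \<and> V \<subseteq> \<Inter>\<C>"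
    by (intro bexI[OF _ star_clopen[of P]] bexI[OF _ star_clopen[of Q]] conjI)
qed

section \<open>Finite compactifications of a punctured space\<close>

locale punctured_compactification = X: parovicenko_space X for X :: "'a topology" +
  fixes x :: 'a and Z :: "'b topology" and e :: "'a \<Rightarrow> 'b"
  assumes x: "x \<in> topspace X"
    and compactification: "finite_compactification (subtopology X (topspace X - {x})) Z e"
begin

section \<open>Transfer of clopen sets between \<open>X\<close> and \<open>Z\<close>\<close>

definition "Y = topspace X - {x}"

definition "R = topspace Z - e ` Y"

definition pull :: "'b set \<Rightarrow> 'a set" where
  "pull C = {y \<in> Y. e y \<in> C}"

lemma topspace_Y: "topspace (subtopology X Y) = Y"
  by (auto simp: Y_def)

lemma Z: "compact_space Z" "Hausdorff_space Z" "embedding_map (subtopology X Y) Z e"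
    "Z closure_of (e ` Y) = topspace Z" "finite R"
  using compactification topspace_Y
  unfolding finite_compactification_def compactification_def R_def Y_def by simp_all

lemma homeomorphic: "homeomorphic_map (subtopology X Y) (subtopology Z (e ` Y)) e"
  using Z(3) unfolding embedding_map_def topspace_Y .

lemma continuous: "continuous_map (subtopology X Y) Z e"
  using homeomorphic_imp_continuous_map[OF homeomorphic] continuous_map_in_subtopology by blast

lemma inj: "inj_on e Y"
  using homeomorphic_imp_injective_map[OF homeomorphic] by (simp only: topspace_Y)

lemma image_subset: "e ` Y \<subseteq> topspace Z"
  using continuous_map_image_subset_topspace[OF continuous] by (simp only: topspace_Y)

lemma in_image_iff: "z \<in> topspace Z \<Longrightarrow> z \<notin> R \<longleftrightarrow> z \<in> e ` Y"
  by (simp add: R_def)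

lemma closedin_R: "A \<subseteq> insert q R \<Longrightarrow> q \<in> topspace Z \<Longrightarrow> closedin Z A"
  by (rule closedin_Hausdorff_finite[OF Z(2)])
    (use Z(5) finite_subset in \<open>auto simp: R_def\<close>)

lemma openin_Y: "openin X Y"
  unfolding Y_def using closedin_Hausdorff_sing_eq[OF X.Hausdorff, of x] x by auto

lemma openin_image: "openin Z (e ` Y)"
proof -
  have "closedin Z R" by (rule closedin_Hausdorff_finite[OF Z(2) _ Z(5)]) (auto simp: R_def)
  moreover have "e ` Y = topspace Z - R" using image_subset by (auto simp: R_def)
  ultimately show ?thesis by auto
qed

text \<open>Openness survives because \<open>Y\<close> is open in \<open>X\<close> and its image is
  open in \<open>Z\<close>, the remainder being finite; closedness survives because \<open>D\<close>
  is compact inside \<open>Y\<close>. The same reasoning backwards gives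
  \<open>pull_clopen\<close>.\<close>

lemma push_clopen:
  assumes "D \<in> clopens X" "x \<notin> D"
  shows "e ` D \<in> clopens Z" "e ` D \<inter> R = {}"
proof -
  have DY: "D \<subseteq> Y" using clopens_subset[OF assms(1)] assms(2) by (auto simp: Y_def)
  have "openin (subtopology X Y) D"
    using DY clopens_openin[OF assms(1)] openin_Y by (simp add: openin_open_subtopology)
  then have "openin (subtopology Z (e ` Y)) (e ` D)"
    using homeomorphic_map_openness[OF homeomorphic, unfolded topspace_Y, OF DY] by blast
  then have "openin Z (e ` D)" by (rule openin_trans_full[OF _ openin_image])
  moreover have "compactin X D"
    by (rule closedin_compact_space[OF X.compact clopens_closedin[OF assms(1)]])
  then have "compactin (subtopology X Y) D" using DY by (simp add: compactin_subtopology)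
  then have "compactin Z (e ` D)" by (rule image_compactin[OF _ continuous])
  then have "closedin Z (e ` D)" by (rule compactin_imp_closedin[OF Z(2)])
  ultimately show "e ` D \<in> clopens Z" by (simp add: clopens_def)
  show "e ` D \<inter> R = {}" using DY by (auto simp: R_def)
qed

lemma pull_clopen:
  assumes "C \<in> clopens Z" "C \<inter> R = {}"
  shows "pull C \<in> clopens X" "x \<notin> pull C" "e ` pull C = C"
proof -
  have C: "C \<subseteq> e ` Y" using clopens_subset[OF assms(1)] assms(2) by (auto simp: R_def)
  then show image: "e ` pull C = C" by (auto simp: pull_def)
  show "x \<notin> pull C" by (simp add: pull_def Y_def)
  have pY: "pull C \<subseteq> Y" by (auto simp: pull_def)
  have "openin (subtopology Z (e ` Y)) C"
    using C clopens_openin[OF assms(1)] openin_image by (simp add: openin_open_subtopology)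
  then have "openin (subtopology X Y) (pull C)"
    using homeomorphic_map_openness[OF homeomorphic, unfolded topspace_Y, OF pY] image by simp
  then have "openin X (pull C)" by (rule openin_trans_full[OF _ openin_Y])
  moreover have "compactin Z C"
    by (rule closedin_compact_space[OF Z(1) clopens_closedin[OF assms(1)]])
  then have "compactin (subtopology Z (e ` Y)) C" using C by (simp add: compactin_subtopology)
  then have "compactin (subtopology X Y) (pull C)"
    using homeomorphic_map_compactness[OF homeomorphic, unfolded topspace_Y, OF pY] image by simp
  then have "compactin X (pull C)" by (simp add: compactin_subtopology)
  then have "closedin X (pull C)" by (rule compactin_imp_closedin[OF X.Hausdorff])
  ultimately show "pull C \<in> clopens X" by (simp add: clopens_def)
qed

lemma stone_space_Z: "stone_space Z"
proof
  show "compact_space Z" by (rule Z(1))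
  fix p q assume pq: "p \<in> topspace Z" "q \<in> topspace Z" "p \<noteq> q"
  have 1: "closedin Z (insert q R - {p})" using pq by (intro closedin_R[of _ q]) auto
  have 2: "p \<in> topspace Z - (insert q R - {p})" using pq by simp
  obtain U V where UV: "openin Z U" "openin Z V" "p \<in> U"
      "insert q R - {p} \<subseteq> V" "disjnt U V"
    using compact_Hausdorff_imp_regular_space[OF Z(1,2), unfolded regular_space_def,
        rule_format, OF conjI[OF 1 2]]
    by (elim exE conjE)
  define K where "K = topspace Z - V - U"
  have K: "compactin Z K"
    unfolding K_def using UV by (intro closedin_compact_space[OF Z(1)] closedin_diff) auto
  have "\<exists>G\<in>clopens Z. k \<in> G \<and> q \<notin> G" if k: "k \<in> K" for k
  proof -
    have kZ: "k \<in> topspace Z" "k \<notin> R" "k \<noteq> q" using k UV pq by (auto simp: K_def)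
    then obtain y where y: "y \<in> Y" "k = e y" using in_image_iff by blast
    then have "y \<in> topspace X" "y \<noteq> x" by (auto simp: Y_def)
    then obtain C where C: "C \<in> clopens X" "y \<in> C" "x \<notin> C"
      using X.clopen_points[of y x] x by blast
    show ?thesis
    proof (cases "q \<in> e ` Y")
      case True
      then obtain q' where q': "q' \<in> Y" "q = e q'" by blast
      then have "y \<noteq> q'" using y kZ by blast
      moreover have "q' \<in> topspace X" using q' by (simp add: Y_def)
      ultimately obtain D where D: "D \<in> clopens X" "y \<in> D" "q' \<notin> D"
        using X.clopen_points[of y q'] \<open>y \<in> topspace X\<close> by blast
      have CD: "C \<inter> D \<in> clopens X" "x \<notin> C \<inter> D" using C D by auto
      have "q \<notin> e ` (C \<inter> D)"
      proof
        assume "q \<in> e ` (C \<inter> D)"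
        then obtain y' where "y' \<in> C \<inter> D" "e y' = e q'" using q' by auto
        moreover from this have "y' \<in> Y" using C clopens_subset[OF C(1)] by (auto simp: Y_def)
        ultimately have "y' = q'" using inj q' by (auto dest: inj_onD)
        then show False using \<open>y' \<in> C \<inter> D\<close> D by blast
      qed
      then show ?thesis using push_clopen[OF CD] y C D by (intro bexI[of _ "e ` (C \<inter> D)"]) auto
    next
      case False
      have "C \<subseteq> Y" using C clopens_subset[OF C(1)] by (auto simp: Y_def)
      then have "q \<notin> e ` C" using False by blast
      then show ?thesis using push_clopen[OF C(1,3)] y C by (intro bexI[of _ "e ` C"]) auto
    qed
  qed
  then have "K \<subseteq> \<Union>{G \<in> clopens Z. q \<notin> G}" by blast
  moreover have "\<forall>G\<in>{G \<in> clopens Z. q \<notin> G}. openin Z G" by (auto simp: clopens_openin)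
  ultimately obtain \<F> where \<F>: "finite \<F>" "\<F> \<subseteq> {G \<in> clopens Z. q \<notin> G}" "K \<subseteq> \<Union>\<F>"
    using K[unfolded compactin_def, THEN conjunct2, rule_format, of "{G \<in> clopens Z. q \<notin> G}"]
    by (metis (no_types, lifting))
  then have G: "\<Union>\<F> \<in> clopens Z" "q \<notin> \<Union>\<F>" by (auto intro!: clopens_Union)
  have "U \<union> \<Union>\<F> = (topspace Z - V) \<union> \<Union>\<F>"
    using UV \<F>(3) openin_subset[OF UV(1)] by (auto simp: K_def disjnt_iff)
  then have "closedin Z (U \<union> \<Union>\<F>)" using UV(2) clopens_closedin[OF G(1)] by auto
  moreover have "openin Z (U \<union> \<Union>\<F>)" using UV(1) clopens_openin[OF G(1)] by blast
  moreover have "q \<notin> U \<union> \<Union>\<F>" using UV(4,5) pq G(2) by (auto simp: disjnt_iff)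
  ultimately show "\<exists>C\<in>clopens Z. p \<in> C \<and> q \<notin> C"
    using UV(3) by (intro bexI[of _ "U \<union> \<Union>\<F>"]) (auto simp: clopens_def)
qed

lemma small_clopen:
  assumes "p \<in> topspace Z"
  shows "\<exists>N\<in>clopens Z. p \<in> N \<and> N \<inter> R \<subseteq> {p}"
proof -
  have "closedin Z (R - {p})" using assms by (intro closedin_R[of _ p]) auto
  from stone_space.clopen_point_closed[OF stone_space_Z assms this]
  obtain N where "N \<in> clopens Z" "p \<in> N" "N \<inter> (R - {p}) = {}" by blast
  then show ?thesis by (intro bexI[of _ N]) auto
qed

text \<open>The separating clopen set of \<^term>\<open>X\<close> may contain \<^term>\<open>x\<close>, but then its complement does not;
  hence only one of the two families is enclosed, and we cannot choose which.\<close>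

lemma separate_missing:
  assumes AB: "countable \<A>" "countable \<B>" "\<A> \<subseteq> clopens Z" "\<B> \<subseteq> clopens Z"
    and miss: "\<And>A. A \<in> \<A> \<union> \<B> \<Longrightarrow> A \<inter> R = {}"
    and disj: "\<And>A B. A \<in> \<A> \<Longrightarrow> B \<in> \<B> \<Longrightarrow> A \<inter> B = {}"
  obtains C where "C \<in> clopens Z" "C \<inter> R = {}"
    "(\<Union>\<A> \<subseteq> C \<and> C \<inter> \<Union>\<B> = {}) \<or> (\<Union>\<B> \<subseteq> C \<and> C \<inter> \<Union>\<A> = {})"
proof -
  have "pull A \<inter> pull B = {}" if "A \<in> \<A>" "B \<in> \<B>" for A B
    using disj[OF that] by (auto simp: pull_def)
  then obtain D where D: "D \<in> clopens X" "\<Union>(pull ` \<A>) \<subseteq> D" "D \<inter> \<Union>(pull ` \<B>) = {}"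
    using X.separate[of "pull ` \<A>" "pull ` \<B>"] AB miss pull_clopen(1)
    by (smt (verit, ccfv_threshold) Un_iff countable_image image_iff image_subset_iff subsetD)
  \<comment> \<open>Two transfers in one, enclosure by \<open>E\<close> and disjointness from
    \<open>D'\<close>; below, \<open>D' = {}\<close> or \<open>E = UNIV\<close> switches off the one
    that is not wanted.\<close>
  have img: "A \<subseteq> e ` E \<and> (D' \<inter> pull A = {} \<longrightarrow> D' \<subseteq> Y \<longrightarrow> e ` D' \<inter> A = {})"
    if "A \<in> \<A> \<union> \<B>" "E \<inter> pull A = pull A" for A E D'
  proof -
    have "e ` pull A = A" using pull_clopen(3)[OF _ miss[OF that(1)]] that(1) AB by blast
    moreover have "e ` D' \<inter> A = {}" if "D' \<inter> pull A = {}" "D' \<subseteq> Y"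
      using that by (auto simp: pull_def)
    ultimately show ?thesis using that(2) by blast
  qed
  show thesis
  proof (cases "x \<in> D")
    case False
    have "D \<subseteq> Y" using clopens_subset[OF D(1)] False by (auto simp: Y_def)
    have "\<Union>\<A> \<subseteq> e ` D"
    proof (rule Union_least)
      fix A assume "A \<in> \<A>"
      then show "A \<subseteq> e ` D" using img[of A D "{}"] D(2) by blast
    qed
    moreover have "e ` D \<inter> B = {}" if "B \<in> \<B>" for B
    proof -
      have "D \<inter> pull B = {}" using D(3) that by blast
      then show ?thesis using img[of B UNIV D] that \<open>D \<subseteq> Y\<close> by simp
    qed
    ultimately show thesis using that[OF push_clopen[OF D(1) False]] by blast
  next
    case True
    let ?D = "topspace X - D"
    have D': "?D \<in> clopens X" "x \<notin> ?D" using D(1) True by auto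
    have "?D \<subseteq> Y" using True by (auto simp: Y_def)
    have "\<Union>\<B> \<subseteq> e ` ?D"
    proof (rule Union_least)
      fix B assume B: "B \<in> \<B>"
      have "pull B \<subseteq> topspace X" by (auto simp: pull_def Y_def)
      then have "?D \<inter> pull B = pull B" using D(3) B by blast
      then show "B \<subseteq> e ` ?D" using img[of B ?D "{}"] B by blast
    qed
    moreover have "e ` ?D \<inter> A = {}" if "A \<in> \<A>" for A
    proof -
      have "?D \<inter> pull A = {}" using D(2) that by blast
      then show ?thesis using img[of A UNIV ?D] that \<open>?D \<subseteq> Y\<close> by simp
    qed
    ultimately show thesis using that[OF push_clopen[OF D']] by blast
  qed
qed

text \<open>It is enough that the unions have disjoint closures. A common closure point
  \<open>p\<close> lies in neither union, so intersecting the families with a clopen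
  \<open>N\<close> whose only possible remainder point is \<open>p\<close> makes them miss the
  remainder. Then \<open>separate_missing\<close> applies, and whichever family it encloses,
  \<open>p\<close> cannot be in both closures.\<close>

lemma separate_Z:
  assumes AB: "countable \<A>" "countable \<B>" "\<A> \<subseteq> clopens Z" "\<B> \<subseteq> clopens Z"
    and disj: "\<And>A B. A \<in> \<A> \<Longrightarrow> B \<in> \<B> \<Longrightarrow> A \<inter> B = {}"
  shows "\<exists>C\<in>clopens Z. \<Union>\<A> \<subseteq> C \<and> C \<inter> \<Union>\<B> = {}"
proof -
  have avoid: "p \<notin> \<Union>\<A>" if "p \<in> Z closure_of \<Union>\<B>" "\<A> \<subseteq> clopens Z"
    "\<And>A B. A \<in> \<A> \<Longrightarrow> B \<in> \<B> \<Longrightarrow> A \<inter> B = {}" for \<A> \<B> p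
  proof
    assume "p \<in> \<Union>\<A>"
    then obtain A where A: "A \<in> \<A>" "p \<in> A" by blast
    then have "openin Z A" using that(2) clopens_openin by blast
    with that(1) A(2) obtain z where "z \<in> \<Union>\<B>" "z \<in> A" by (meson in_closure_of)
    then show False using that(3) A(1) by blast
  qed
  have local: False if p: "p \<in> Z closure_of \<Union>\<A>" "p \<in> Z closure_of \<Union>\<B>"
    and N: "N \<in> clopens Z" "p \<in> N" and C: "C \<in> clopens Z" "\<Union>((\<inter>) N ` \<A>) \<subseteq> C" "C \<inter> \<Union>((\<inter>) N ` \<B>) = {}"
    for \<A> \<B> p N C
  proof (cases "p \<in> C")
    case True
    then have "openin Z (N \<inter> C)" "p \<in> N \<inter> C" using N C(1) by (auto simp: clopens_openin)
    with p(2) obtain z where "z \<in> \<Union>\<B>" "z \<in> N \<inter> C" by (meson in_closure_of)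
    then show False using C(3) by blast
  next
    case False
    then have "openin Z (N - C)" "p \<in> N - C" using N C(1) by (auto simp: clopens_openin)
    with p(1) obtain z where "z \<in> \<Union>\<A>" "z \<in> N - C" by (meson in_closure_of)
    then show False using C(2) by blast
  qed
  have "Z closure_of \<Union>\<A> \<inter> Z closure_of \<Union>\<B> = {}"
  proof (rule ccontr)
    assume "Z closure_of \<Union>\<A> \<inter> Z closure_of \<Union>\<B> \<noteq> {}"
    then obtain p where p: "p \<in> Z closure_of \<Union>\<A>" "p \<in> Z closure_of \<Union>\<B>" by blast
    have out: "p \<notin> \<Union>\<A>" "p \<notin> \<Union>\<B>"
      using avoid[OF p(2) AB(3)] avoid[OF p(1) AB(4)] disj by (blast, metis inf_commute)
    have "p \<in> topspace Z" using p(1) by (simp add: in_closure_of)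
    then obtain N where N: "N \<in> clopens Z" "p \<in> N" "N \<inter> R \<subseteq> {p}" using small_clopen by blast
    have "(\<inter>) N ` \<A> \<subseteq> clopens Z" "(\<inter>) N ` \<B> \<subseteq> clopens Z" using AB N(1) by auto
    moreover have "A \<inter> R = {}" if "A \<in> (\<inter>) N ` \<A> \<union> (\<inter>) N ` \<B>" for A
      using that N(3) out by blast
    moreover have "A \<inter> B = {}" if "A \<in> (\<inter>) N ` \<A>" "B \<in> (\<inter>) N ` \<B>" for A B
      using that disj by blast
    ultimately obtain C where C: "C \<in> clopens Z"
      "(\<Union>((\<inter>) N ` \<A>) \<subseteq> C \<and> C \<inter> \<Union>((\<inter>) N ` \<B>) = {}) \<or> (\<Union>((\<inter>) N ` \<B>) \<subseteq> C \<and> C \<inter> \<Union>((\<inter>) N ` \<A>) = {})"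
      using separate_missing[OF countable_image[OF AB(1), of "(\<inter>) N"] countable_image[OF AB(2), of "(\<inter>) N"]]
      by metis
    then show False using local[OF p N(1,2) C(1)] local[OF p(2,1) N(1,2) C(1)] by blast
  qed
  then obtain C where C: "C \<in> clopens Z" "Z closure_of \<Union>\<A> \<subseteq> C" "C \<inter> Z closure_of \<Union>\<B> = {}"
    using stone_space.clopen_separation[OF stone_space_Z closedin_closure_of closedin_closure_of] by blast
  moreover have "\<Union>\<A> \<subseteq> Z closure_of \<Union>\<A>" "\<Union>\<B> \<subseteq> Z closure_of \<Union>\<B>"
    using AB clopens_subset by (intro closure_of_subset Union_least; blast)+
  ultimately show ?thesis by (intro bexI[OF _ C(1)]) blast
qed

section \<open>Thickness of \<open>Z\<close>\<close>

lemma dense: "openin Z T \<Longrightarrow> T \<noteq> {} \<Longrightarrow> \<exists>y\<in>Y. e y \<in> T"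
  using Z(4) unfolding dense_intersects_open by blast

text \<open>If a countable intersection of clopen sets consisted of remainder points only, then such a point
  would have a countable base, and the even and the odd differences of this base would be two
  disjoint families of which neither is enclosed by a clopen set that misses the remainder.\<close>

lemma Inter_meets_image:
  assumes \<C>: "countable \<C>" "\<C> \<subseteq> clopens Z" and p: "p \<in> topspace Z" "p \<in> \<Inter>\<C>"
  shows "\<exists>y\<in>Y. e y \<in> \<Inter>\<C>"
proof (rule ccontr)
  assume no: "\<not> ?thesis"
  then have pR: "p \<in> R" using p by (auto simp: R_def)
  obtain N where N: "N \<in> clopens Z" "p \<in> N" "N \<inter> R \<subseteq> {p}" using small_clopen[OF p(1)] by blast
  define c where "c = from_nat_into (insert (topspace Z) \<C>)"
  have c: "range c = insert (topspace Z) \<C>"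
    unfolding c_def using \<C>(1) by (intro range_from_nat_into) auto
  \<comment> \<open>These decreasing clopen sets meet only in \<open>p\<close>: image points are
    excluded by assumption, other remainder points by the choice of \<open>N\<close>.\<close>
  define d where "d n = N \<inter> (topspace Z \<inter> \<Inter>(c ` {..n}))" for n :: nat
  have d_clopen: "d n \<in> clopens Z" for n
  proof -
    have "c ` {..n} \<subseteq> insert (topspace Z) \<C>" 
      using image_mono[OF subset_UNIV, of c "{..n}"] unfolding c .
    also have "\<dots> \<subseteq> clopens Z" using \<C>(2) by simp
    finally have "topspace Z \<inter> \<Inter>(c ` {..n}) \<in> clopens Z" by (intro clopens_finite_Inter) simp
    then show ?thesis unfolding d_def by (rule clopens_Int[OF N(1)])
  qed
  have p_c: "p \<in> c n" for n
  proof -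
    have "c n \<in> insert (topspace Z) \<C>" using rangeI[of c n] unfolding c .
    then show ?thesis using p by auto
  qed
  have p_d: "p \<in> d n" for n using p p_c N(2) by (simp add: d_def)
  have d_mono: "d n \<subseteq> d m" if "m \<le> n" for m n using that by (auto simp: d_def)
  have d_Inter: "z = p" if z: "\<And>n. z \<in> d n" for z
  proof -
    have zN: "z \<in> N" "z \<in> topspace Z" using z[of 0] by (auto simp: d_def)
    have "z \<in> c n" for n using z[of n] by (simp add: d_def)
    then have "z \<in> \<Inter>(range c)" by blast
    then have "z \<in> \<Inter>\<C>" by (simp add: c)
    then have "z \<notin> e ` Y" using no by blast
    then show "z = p" using zN N(3) by (auto simp: R_def)
  qed
  \<comment> \<open>By density every \<open>d m\<close> contains an image point, which differs from
    \<open>p\<close> and so drops out later; a subsequence is therefore strictly decreasing.\<close>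
  have "\<exists>k :: nat \<Rightarrow> nat. \<forall>i. True \<and> k i < k (Suc i) \<and> \<not> d (k i) \<subseteq> d (k (Suc i))"
  proof (rule dependent_nat_choice)
    fix m i :: nat
    obtain y where y: "y \<in> Y" "e y \<in> d m"
      using dense[OF clopens_openin[OF d_clopen[of m]]] p_d[of m] by blast
    then have "e y \<noteq> p" using pR by (auto simp: R_def)
    then obtain l where l: "e y \<notin> d l" using d_Inter by blast
    have "d (max (Suc m) l) \<subseteq> d l" by (rule d_mono) simp
    then have "\<not> d m \<subseteq> d (max (Suc m) l)" using l y by blast
    then show "\<exists>n. True \<and> m < n \<and> \<not> d m \<subseteq> d n"
      by (intro exI[of _ "max (Suc m) l"]) auto
  qed simp
  then obtain k where k: "\<And>i. k i < k (Suc i)" "\<And>i. \<not> d (k i) \<subseteq> d (k (Suc i))" by blast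
  have k_mono: "strict_mono k" using k(1) by (simp add: strict_mono_Suc_iff)
  define L where "L i = d (k i) - d (k (Suc i))" for i
  have L_clopen: "L i \<in> clopens Z" for i unfolding L_def using d_clopen by simp
  have L_miss: "L i \<inter> R = {}" for i
    using N(3) p_d[of "k (Suc i)"] unfolding L_def d_def by blast
  have L_nonempty: "L i \<noteq> {}" for i using k(2)[of i] by (auto simp: L_def)
  have L_small: "L i \<subseteq> d n" if "n \<le> i" for i n
  proof -
    have "n \<le> k i" using that strict_mono_imp_increasing[OF k_mono, of i] by linarith
    then show ?thesis using d_mono[of n "k i"] by (auto simp: L_def)
  qed
  have L_disjoint: "L i \<inter> L j = {}" if "i < j" for i j
  proof -
    have "k (Suc i) \<le> k j" using that k_mono by (simp add: strict_mono_less_eq)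
    then show ?thesis using d_mono[of "k (Suc i)" "k j"] by (auto simp: L_def)
  qed
  \<comment> \<open>A clopen \<open>C\<close> containing differences arbitrarily far out (hence
    \<open>n \<le> f n\<close>) meets every \<open>d n\<close>. By compactness it contains
    \<open>p\<close>, although it misses the remainder.\<close>
  have bounded: False
    if C: "C \<in> clopens Z" "C \<inter> R = {}" and f: "\<And>n. n \<le> f n" "\<And>n. L (f n) \<subseteq> C" for C f
  proof -
    have "topspace Z \<inter> \<Inter>(insert C (range d)) \<noteq> {}"
    proof (rule stone_space.clopens_Inter_nonempty[OF stone_space_Z])
      show "insert C (range d) \<subseteq> clopens Z" using C(1) d_clopen by blast
      show "topspace Z \<noteq> {}" using p(1) by blast
      fix \<F> assume \<F>: "finite \<F>" "\<F> \<subseteq> insert C (range d)"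
      then have "finite (\<F> - {C})" "\<F> - {C} \<subseteq> d ` UNIV" by blast+
      then obtain J where J: "finite J" "\<F> - {C} = d ` J" by (meson finite_subset_image)
      obtain M where M: "\<forall>j\<in>J. j \<le> M"
        using J(1) unfolding finite_nat_set_iff_bounded_le by (rule exE)
      have "L (f M) \<subseteq> D" if "D \<in> \<F>" for D
      proof (cases "D = C")
        case False
        then have "D \<in> d ` J" using that J(2) by blast
        then obtain j where j: "j \<in> J" "D = d j" by blast
        then have "j \<le> f M" using M f(1)[of M] by (meson order_trans)
        then show ?thesis using L_small[of j "f M"] j(2) by simp
      qed (use f(2) in blast)
      moreover have "L (f M) \<subseteq> topspace Z" by (rule clopens_subset[OF L_clopen])
      ultimately have "L (f M) \<subseteq> topspace Z \<inter> \<Inter>\<F>" by blast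
      then show "topspace Z \<inter> \<Inter>\<F> \<noteq> {}" using L_nonempty[of "f M"] by blast
    qed
    then obtain z where z: "z \<in> C" "\<And>n. z \<in> d n" by blast
    then have "z = p" using d_Inter by blast
    then show False using z(1) C(2) pR by blast
  qed
  define \<A> where "\<A> = range (\<lambda>i. L (2 * i))"
  define \<B> where "\<B> = range (\<lambda>i. L (Suc (2 * i)))"
  have fam: "countable \<A>" "countable \<B>" "\<A> \<subseteq> clopens Z" "\<B> \<subseteq> clopens Z"
    using L_clopen by (auto simp: \<A>_def \<B>_def)
  have miss: "A \<inter> R = {}" if "A \<in> \<A> \<union> \<B>" for A
    using that L_miss by (auto simp: \<A>_def \<B>_def)
  have disj: "A \<inter> B = {}" if AB: "A \<in> \<A>" "B \<in> \<B>" for A B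
  proof -
    from AB obtain i j where ij: "A = L (2 * i)" "B = L (Suc (2 * j))"
      by (auto simp: \<A>_def \<B>_def)
    have "2 * i < Suc (2 * j) \<or> Suc (2 * j) < 2 * i" by presburger
    then show ?thesis using ij L_disjoint[of "2 * i" "Suc (2 * j)"] L_disjoint[of "Suc (2 * j)" "2 * i"]
      by (auto simp: Int_commute)
  qed
  obtain C where C: "C \<in> clopens Z" "C \<inter> R = {}"
    "(\<Union>\<A> \<subseteq> C \<and> C \<inter> \<Union>\<B> = {}) \<or> (\<Union>\<B> \<subseteq> C \<and> C \<inter> \<Union>\<A> = {})"
    by (rule separate_missing[OF fam]) (erule miss, erule (1) disj, rule that)
  from C(3) show False
  proof (elim disjE conjE)
    assume "\<Union>\<A> \<subseteq> C"
    then have "L (2 * i) \<subseteq> C" for i by (auto simp: \<A>_def)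
    then show False using bounded[OF C(1,2), of "\<lambda>i. 2 * i"] by simp
  next
    assume "\<Union>\<B> \<subseteq> C"
    then have "L (Suc (2 * i)) \<subseteq> C" for i by (auto simp: \<B>_def)
    then show False using bounded[OF C(1,2), of "\<lambda>i. Suc (2 * i)"] by simp
  qed
qed

text \<open>Since the intersection contains an image point \<open>e y\<close>, the problem can be
  moved into a clopen neighbourhood \<open>K\<close> of \<open>y\<close> that avoids
  \<open>x\<close>, where thickness of \<open>X\<close> solves it.\<close>

lemma thick_Z:
  assumes \<C>: "countable \<C>" "\<C> \<subseteq> clopens Z" and p: "p \<in> topspace Z" "p \<in> \<Inter>\<C>"
  shows "\<exists>U\<in>clopens Z. \<exists>V\<in>clopens Z. U \<noteq> {} \<and> V \<noteq> {} \<and> U \<inter> V = {} \<and> U \<subseteq> \<Inter>\<C> \<and> V \<subseteq> \<Inter>\<C>"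
proof -
  obtain y where y: "y \<in> Y" "e y \<in> \<Inter>\<C>" using Inter_meets_image[OF assms] by blast
  then have yX: "y \<in> topspace X" "y \<noteq> x" by (auto simp: Y_def)
  then obtain K where K: "K \<in> clopens X" "y \<in> K" "x \<notin> K" using X.clopen_points[of y x] x by blast
  have KY: "K \<subseteq> Y" using clopens_subset[OF K(1)] K(3) by (auto simp: Y_def)
  \<comment> \<open>Including \<open>K\<close> itself keeps \<open>U\<close> and \<open>V\<close>
    away from \<open>x\<close>, as \<open>push_clopen\<close> demands.\<close>
  define \<D> where "\<D> = insert K ((\<lambda>C. pull (C \<inter> e ` K)) ` \<C>)"
  have "countable \<D>" using \<C>(1) by (simp add: \<D>_def)
  moreover have "\<D> \<subseteq> clopens X"
  proof -
    have "pull (C \<inter> e ` K) \<in> clopens X" if "C \<in> \<C>" for C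
      using that \<C>(2) push_clopen[OF K(1,3)] by (intro pull_clopen) auto
    then show ?thesis using K(1) by (auto simp: \<D>_def)
  qed
  moreover have "y \<in> \<Inter>\<D>" using y K(2) by (auto simp: \<D>_def pull_def)
  ultimately obtain U V where UV: "U \<in> clopens X" "V \<in> clopens X" "U \<noteq> {}" "V \<noteq> {}"
      "U \<inter> V = {}" "U \<subseteq> \<Inter>\<D>" "V \<subseteq> \<Inter>\<D>"
    using X.thick[OF _ _ yX(1), of \<D>] by metis
  have UVY: "U \<subseteq> Y" "V \<subseteq> Y" "x \<notin> U" "x \<notin> V" using UV KY K(3) by (auto simp: \<D>_def)
  have sub: "e ` W \<subseteq> \<Inter>\<C>" if "W \<subseteq> \<Inter>\<D>" for W
  proof (rule Inter_greatest)
    fix C assume "C \<in> \<C>"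
    then have "W \<subseteq> pull (C \<inter> e ` K)" using that by (auto simp: \<D>_def)
    then show "e ` W \<subseteq> C" by (auto simp: pull_def)
  qed
  have "e ` U \<inter> e ` V = e ` (U \<inter> V)" by (rule inj_on_image_Int[OF inj UVY(1,2), symmetric])
  then show ?thesis
    using UV sub push_clopen(1)[OF UV(1) UVY(3)] push_clopen(1)[OF UV(2) UVY(4)]
    by (intro bexI[of _ "e ` U"] bexI[of _ "e ` V"]) auto
qed

text \<open>The finite remainder admits finitely many traces. A clopen set is recovered from its
  trace and its symmetric difference with a fixed clopen set of that trace; this difference misses
  the remainder and so comes from a clopen set of \<open>X\<close>.\<close>

lemma few_clopens_Z: "clopens Z \<lesssim> (UNIV :: real set)"
proof -
  define rep where "rep S = (SOME C. C \<in> clopens Z \<and> C \<inter> R = S)" for S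
  have rep: "rep (C \<inter> R) \<in> clopens Z" "rep (C \<inter> R) \<inter> R = C \<inter> R" if "C \<in> clopens Z" for C
    using someI[of "\<lambda>D. D \<in> clopens Z \<and> D \<inter> R = C \<inter> R" C] that by (auto simp: rep_def)
  define \<Delta> where "\<Delta> C = (C - rep (C \<inter> R)) \<union> (rep (C \<inter> R) - C)" for C
  have \<Delta>: "\<Delta> C \<in> clopens Z" "\<Delta> C \<inter> R = {}" if "C \<in> clopens Z" for C
    using rep[OF that] that by (auto simp: \<Delta>_def)
  have "inj_on (\<lambda>C. (C \<inter> R, pull (\<Delta> C))) (clopens Z)"
  proof (rule inj_onI)
    fix C D assume CD: "C \<in> clopens Z" "D \<in> clopens Z" "(C \<inter> R, pull (\<Delta> C)) = (D \<inter> R, pull (\<Delta> D))"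
    then have "\<Delta> C = \<Delta> D" using pull_clopen(3)[OF \<Delta>] by (metis prod.inject)
    moreover have "C = (\<Delta> C - rep (C \<inter> R)) \<union> (rep (C \<inter> R) - \<Delta> C)" for C by (auto simp: \<Delta>_def)
    ultimately show "C = D" using CD(3) by (metis prod.inject)
  qed
  moreover have "(\<lambda>C. (C \<inter> R, pull (\<Delta> C))) ` clopens Z \<subseteq> Pow R \<times> clopens X"
    using pull_clopen(1)[OF \<Delta>] by auto
  ultimately have "clopens Z \<lesssim> Pow R \<times> clopens X" unfolding lepoll_def by blast
  also have "Pow R \<times> clopens X \<lesssim> (UNIV :: real set) \<times> (UNIV :: real set)"
    using Z(5) by (intro times_lepoll_mono X.few_clopens finite_lepoll_infinite infinite_UNIV_char_0) simp
  also have "(UNIV :: real set) \<times> (UNIV :: real set) \<approx> (UNIV :: real set)"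
    unfolding eqpoll_iff_card_of_ordIso by (rule card_of_Times_same_infinite[OF infinite_UNIV_char_0])
  finally show ?thesis .
qed

lemma parovicenko_space_Z: "parovicenko_space Z"
proof (intro parovicenko_space.intro parovicenko_space_axioms.intro stone_space_Z
    few_clopens_Z separate_Z thick_Z)
  \<comment> \<open>For the empty family thickness yields two distinct points of \<open>X\<close>,
    and one of them differs from \<open>x\<close>.\<close>
  obtain U V where "U \<in> clopens X" "V \<in> clopens X" "U \<noteq> {}" "V \<noteq> {}" "U \<inter> V = {}"
    using X.thick[of "{}" x] x by auto
  then obtain u v where "u \<in> topspace X" "v \<in> topspace X" "u \<noteq> v" using clopens_subset by blast
  then have "Y \<noteq> {}" by (auto simp: Y_def)
  then show "topspace Z \<noteq> {}" using image_subset by blast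
qed

text \<open>Shrink the neighbourhoods that witness the failure to clopen sets \<open>c M\<close> and
  take the differences \<open>N - c M\<close>, which lose the only possible remainder point
  \<open>p\<close>. If a clopen \<open>C\<close> avoiding \<open>p\<close> contained them all,
  \<open>N - C\<close> would be a neighbourhood of \<open>p\<close> inside the whole
  intersection.\<close>

lemma not_P_point_family:
  assumes p: "p \<in> topspace Z" "\<not> P_point Z p" and N: "N \<in> clopens Z" "p \<in> N" "N \<inter> R \<subseteq> {p}"
  obtains \<A> where "countable \<A>" "\<A> \<subseteq> clopens Z" "\<And>A. A \<in> \<A> \<Longrightarrow> A \<subseteq> N \<and> A \<inter> R = {}"
    "\<And>C. C \<in> clopens Z \<Longrightarrow> p \<notin> C \<Longrightarrow> \<not> \<Union>\<A> \<subseteq> C"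
proof -
  obtain \<N> where \<N>: "countable \<N>" "\<forall>M\<in>\<N>. neighbourhood Z p M"
    "\<And>U. openin Z U \<Longrightarrow> p \<in> U \<Longrightarrow> \<not> U \<subseteq> \<Inter>\<N>"
    using p unfolding P_point_def by meson
  have "\<exists>C. C \<in> clopens Z \<and> p \<in> C \<and> C \<subseteq> M" if "M \<in> \<N>" for M
  proof -
    obtain U where U: "openin Z U" "p \<in> U" "U \<subseteq> M"
      using \<N>(2) \<open>M \<in> \<N>\<close> unfolding neighbourhood_def by blast
    show ?thesis using stone_space.clopen_neighbourhood[OF stone_space_Z U(1,2)] U(3) by blast
  qed
  then obtain c where c: "\<And>M. M \<in> \<N> \<Longrightarrow> c M \<in> clopens Z \<and> p \<in> c M \<and> c M \<subseteq> M" by metis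
  show thesis
  proof
    show "countable ((\<lambda>M. N - c M) ` \<N>)" using \<N>(1) by simp
    show "(\<lambda>M. N - c M) ` \<N> \<subseteq> clopens Z" using N(1) c by auto
    show "A \<subseteq> N \<and> A \<inter> R = {}" if "A \<in> (\<lambda>M. N - c M) ` \<N>" for A
      using that N(3) c by blast
    show "\<not> \<Union>((\<lambda>M. N - c M) ` \<N>) \<subseteq> C" if C: "C \<in> clopens Z" "p \<notin> C" for C
    proof
      assume sub: "\<Union>((\<lambda>M. N - c M) ` \<N>) \<subseteq> C"
      have "openin Z (N - C)" using N(1) C(1) by (simp add: clopens_openin)
      moreover have "N - C \<subseteq> M" if "M \<in> \<N>" for M
        using sub c[OF that] that by blast
      then have "N - C \<subseteq> \<Inter>\<N>" by blast
      ultimately show False using \<N>(3) N(2) C(2) by blast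
    qed
  qed
qed

lemma remainder_P_point:
  assumes p: "p \<in> R" "\<not> P_point Z p" and q: "q \<in> R" "\<not> P_point Z q"
  shows "p = q"
proof (rule ccontr)
  assume "p \<noteq> q"
  have pq: "p \<in> topspace Z" "q \<in> topspace Z" using p q by (auto simp: R_def)
  obtain N where N: "N \<in> clopens Z" "p \<in> N" "N \<inter> R \<subseteq> {p}" using small_clopen[OF pq(1)] by blast
  obtain M where M: "M \<in> clopens Z" "q \<in> M" "M \<inter> R \<subseteq> {q}" using small_clopen[OF pq(2)] by blast
  \<comment> \<open>Removing \<open>N\<close> makes the two families disjoint, and \<open>q\<close>
    survives because \<open>N\<close> contains no remainder point other than
    \<open>p\<close>.\<close>
  have MN: "M - N \<in> clopens Z" "q \<in> M - N" "(M - N) \<inter> R \<subseteq> {q}"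
    using M N q(1) \<open>p \<noteq> q\<close> by auto
  obtain \<A> where \<A>: "countable \<A>" "\<A> \<subseteq> clopens Z" "\<And>A. A \<in> \<A> \<Longrightarrow> A \<subseteq> N \<and> A \<inter> R = {}"
    "\<And>C. C \<in> clopens Z \<Longrightarrow> p \<notin> C \<Longrightarrow> \<not> \<Union>\<A> \<subseteq> C"
    using not_P_point_family[OF pq(1) p(2) N] by metis
  obtain \<B> where \<B>: "countable \<B>" "\<B> \<subseteq> clopens Z" "\<And>A. A \<in> \<B> \<Longrightarrow> A \<subseteq> M - N \<and> A \<inter> R = {}"
    "\<And>C. C \<in> clopens Z \<Longrightarrow> q \<notin> C \<Longrightarrow> \<not> \<Union>\<B> \<subseteq> C"
    using not_P_point_family[OF pq(2) q(2) MN] by metis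
  have miss: "A \<inter> R = {}" if "A \<in> \<A> \<union> \<B>" for A using that \<A>(3) \<B>(3) by blast
  have disj: "A \<inter> B = {}" if "A \<in> \<A>" "B \<in> \<B>" for A B
    using \<A>(3)[OF that(1)] \<B>(3)[OF that(2)] by blast
  obtain C where C: "C \<in> clopens Z" "C \<inter> R = {}"
    "(\<Union>\<A> \<subseteq> C \<and> C \<inter> \<Union>\<B> = {}) \<or> (\<Union>\<B> \<subseteq> C \<and> C \<inter> \<Union>\<A> = {})"
    by (rule separate_missing[OF \<A>(1) \<B>(1) \<A>(2) \<B>(2)]) (erule miss, erule (1) disj, rule that)
  have "p \<notin> C" "q \<notin> C" using C(2) p(1) q(1) by blast+
  then show False using \<A>(4)[OF C(1)] \<B>(4)[OF C(1)] C(3) by blast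
qed

end

theorem theorem3p2:
  fixes x :: "nat filter" and Z :: "'b topology" and e :: "nat filter \<Rightarrow> 'b"
  assumes "continuum_hypothesis"
    and "x \<in> topspace omega_star"
    and "finite_compactification (subtopology omega_star (topspace omega_star - {x})) Z e"
  shows "Z homeomorphic_space omega_star \<and>
    (\<exists>\<^sub>\<le>\<^sub>1 p. p \<in> topspace Z - e ` (topspace omega_star - {x}) \<and> \<not> P_point Z p)"
proof
  interpret punctured_compactification omega_star x Z e
    using parovicenko_space_omega_star assms(2,3)
    by (intro punctured_compactification.intro punctured_compactification_axioms.intro)
  show "Z homeomorphic_space omega_star"
    by (rule parovicenko[OF assms(1) parovicenko_space_Z parovicenko_space_omega_star])
  show "\<exists>\<^sub>\<le>\<^sub>1 p. p \<in> topspace Z - e ` (topspace omega_star - {x}) \<and> \<not> P_point Z p"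
    using remainder_P_point unfolding Y_def R_def by (intro Uniq_I) blast
qed

end
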